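(* Let $g=0$, and let $U=\{U_j^m\}_{0\le j\le J,\ m\ge 0}$ be a solution of the finite-difference scheme $$C_\theta[\rho_h]\bar\partial_t U^m+\mathcal A_h U^{(\sigma)\,m}=F^m\ \text{ on }\omega_h,\ m\ge 1;\qquad U_0^m=0,\ m\ge 1;\qquad U^0=U^0_h\ \text{ on }\bar\omega_h,$$ $$b_\infty\bar\partial_xU_J^{(\sigma)\,m}+h_J\,s_\theta^-\bigl(\rho_\infty\bar\partial_tU+c_\infty U^{(\sigma)}\bigr)^m_J=b_\infty\mathcal S^m\mathbf U_J^m+G^m,\quad m\ge 1,$$ where $G=\{G^m\}_{m\ge1}$ is given, $\mathbf U^m_J=\{U_J^0,\dots,U_J^m\}$, and for each $m\ge 1$, $\mathcal S^m$ is a linear operator taking a real sequence $\{\Phi^0,\dots,\Phi^m\}$ to a real number. Suppose that $$\sum_{m=1}^M(\mathcal S^m\boldsymbol\Phi^m)\,\Phi^{(\sigma)\,m}\tau_m\le 0\quad\text{for any } M\ge 1$$ for every real function $\Phi$ on $\{t_m\}_{m\ge 0}$ with $\Phi^0=0$ (where $\boldsymbol\Phi^m=\{\Phi^1,\dots,\Phi^m\}$, with $\Phi^0=0$). Then, for $\sigma\ge\frac12$ and $\theta<\frac14$, the bound $$\max\Bigl\{\max_{0\le m\le M}\|U^m\|_{C_\theta[\rho_h]},\ \sqrt2\,\|U\|_{(1)}\Bigr\}\le\|U_h^0\|_{C_\theta[\rho_h]}+\frac{K_\sigma}{\sqrt{c_\theta\underline\rho}}\sum_{m=1}^M\|F^{(0)\,m}\|_{\omega_h}\tau_m+\sqrt{\frac2\nu}\,\Bigl(\|F^{(1)}\|_{\widetilde\omega_M^{h,\tau}}+\sqrt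 X\,\|G\|_{\omega_M^\tau}\Bigr)$$ holds for any $M\ge 1$ and any decomposition $F=F^{(0)}+\widehat\partial_xF^{(1)}$ such that $F^{(1)}|_{j=J}=0$, where $K_\sigma:=2(\sigma+|1-\sigma|)$, $c_\theta=1-4\max\{\theta,0\}$, and $\|U\|_{(1)}$ is given by $$\|U\|_{(1)}^2=(\sigma-\tfrac12)\sum_{m=1}^M\tau_m\|\bar\partial_tU^m\|_{C_\theta[\rho_h]}^2\,\tau_m+\|\sqrt{b_h}\,\bar\partial_xU^{(\sigma)}\|_{\widetilde\omega_M^{h,\tau}}^2+\sum_{m=1}^M\|U^{(\sigma)\,m}\|^2_{C_\theta[c_h]}\tau_m .$$ The bound holds also for $\theta=\frac14$ provided that $F^{(0)}=0$ (the summand with $F^{(0)}$ being dropped). Consequently, for $\sigma\ge\frac12$ and $\theta\le\frac14$, the scheme has a unique solution.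
   Context: All mesh functions are real-valued; $\sigma,\theta$ are real parameters. Coefficients: $\rho,b,c$ are continuous with $\rho(x)\ge\underline\rho>0$, $b(x)\ge\nu>0$, $c(x)\ge 0$ for $x>0$, and for some $X_0>0$: $\rho(x)=\rho_\infty>0$, $b(x)=b_\infty>0$, $c(x)=c_\infty\ge0$ for $x\ge X_0$. Fix $X>X_0$. Meshes: nodes $0=x_0<x_1<\dots<x_J=X<\dots$ with steps $h_j=x_j-x_{j-1}$, $h_J\le X-X_0$, $h_j=h:=h_J$ for $j\ge J$; $x_{j-1/2}=\frac{x_{j-1}+x_j}2$, $h_{j+1/2}=\frac{h_j+h_{j+1}}2$; $\bar\omega_h=\{x_j\}_{j=0}^J$, $\omega_h=\{x_j\}_{j=1}^{J-1}$. In time: $0=t_0<t_1<\dots$, $t_m\to\infty$, $\tau_m=t_m-t_{m-1}$. $H_0(\bar\omega_h)$ is the space of functions on $\bar\omega_h$ vanishing at $x_0=0$. Mesh coefficients: $\rho_{hj}=\rho(x_{j-1/2})$, $b_{hj}=b(x_{j-1/2})$, $c_{hj}=c(x_{j-1/2})$. Data: $F^m$ is given on $\omega_h$ for $m\ge1$; $U_h^0$ is given on $\bar\omega_h$ with $U^0_{h0}=U^0_{hJ}=0$. In the decomposition, $F^{(0)\,m}$ is given on $\omega_h$ and $F^{(1)\,m}$ on $\{x_j\}_{j=1}^J$, $m\ge 1$. Operators: $\bar\partial_xW_j=\frac{W_j-W_{j-1}}{h_j}$, $\widehat\partial_xW_j=\frac{W_{j+1}-W_j}{h_{j+1/2}}$,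 $\widehat s_xW_j=\frac{h_j}{2h_{j+1/2}}W_j+\frac{h_{j+1}}{2h_{j+1/2}}W_{j+1}$, $$C_\theta[\varkappa_h]W_j=\theta\tfrac{h_j}{h_{j+1/2}}\varkappa_{hj}W_{j-1}+(1-2\theta)(\widehat s_x\varkappa_{hj})W_j+\theta\tfrac{h_{j+1}}{h_{j+1/2}}\varkappa_{h,j+1}W_{j+1},$$ $s_\theta^-W_J=\theta W_{J-1}+(\frac12-\theta)W_J$, $\mathcal A_hW=-\widehat\partial_x(b_h\bar\partial_xW)+C_\theta[c_h]W$. In time: $\bar\partial_t\Phi^m=\frac{\Phi^m-\Phi^{m-1}}{\tau_m}$, $\Phi^{(\sigma)\,m}=\sigma\Phi^m+(1-\sigma)\Phi^{m-1}$. Norms: $(V,W)_{\omega_h}=\sum_{j=1}^{J-1}V_jW_jh_{j+1/2}$, $(V,W)_{\widetilde\omega_h}=\sum_{j=1}^JV_jW_jh_j$, with norms $\|\cdot\|_{\omega_h}$, $\|\cdot\|_{\widetilde\omega_h}$. For $\varkappa_h\ge 0$, $\theta\le\frac14$ and $U,W\in H_0(\bar\omega_h)$: $(U,W)_{C_\theta[\varkappa_h]}=(C_\theta[\varkappa_h]U,W)_{\omega_h}+\varkappa_{hJ}(s_\theta^-U)_JW_Jh_J$ and $\|W\|_{C_\theta[\varkappa_h]}=(W,W)_{C_\theta[\varkappa_h]}^{1/2}$ (a norm if $\varkappa_h>0$, a seminorm if $\varkappa_h\ge0$). $\|\Phi\|_{\omega_M^\tau}=(\sum_{m=1}^M(\Phi^m)^2\tau_m)^{1/2}$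 and $\|V\|_{\widetilde\omega_M^{h,\tau}}=(\sum_{m=1}^M\|V^m\|_{\widetilde\omega_h}^2\tau_m)^{1/2}$. *)

theory Defs
  imports Complex_Main
begin

(* Mesh functions are total functions on nat.  A mesh function in space is W :: nat => real,
   read only at the node indices stated; one in space and time is U :: nat => nat => real,
   with U m j the value at the node x j and the time level m. *)

(* h_j for a spatial mesh, tau_m for a time mesh; meaningful for positive indices only. *)
definition mesh_step :: "(nat \<Rightarrow> real) \<Rightarrow> nat \<Rightarrow> real" where
  "mesh_step x j = x j - x (j - 1)"

(* h_{j+1/2} *)
definition half_step :: "(nat \<Rightarrow> real) \<Rightarrow> nat \<Rightarrow> real" where
  "half_step x j = (mesh_step x j + mesh_step x (j + 1)) / 2"

(* The mesh coefficient: the value of k at x_{j-1/2}, for positive j. *)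
definition mesh_coeff :: "(nat \<Rightarrow> real) \<Rightarrow> (real \<Rightarrow> real) \<Rightarrow> nat \<Rightarrow> real" where
  "mesh_coeff x k j = k ((x (j - 1) + x j) / 2)"

definition space_mesh :: "real \<Rightarrow> real \<Rightarrow> nat \<Rightarrow> (nat \<Rightarrow> real) \<Rightarrow> bool" where
  "space_mesh X\<^sub>0 X J x \<longleftrightarrow>
     x 0 = 0 \<and> strict_mono x \<and> x J = X \<and> mesh_step x J \<le> X - X\<^sub>0 \<and>
     (\<forall>j\<ge>J. mesh_step x j = mesh_step x J)"

definition time_mesh :: "(nat \<Rightarrow> real) \<Rightarrow> bool" where
  "time_mesh t \<longleftrightarrow> t 0 = 0 \<and> strict_mono t \<and> filterlim t at_top sequentially"

definition dx_back :: "(nat \<Rightarrow> real) \<Rightarrow> (nat \<Rightarrow> real) \<Rightarrow> nat \<Rightarrow> real" where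
  "dx_back x W j = (W j - W (j - 1)) / mesh_step x j"

definition dx_hat :: "(nat \<Rightarrow> real) \<Rightarrow> (nat \<Rightarrow> real) \<Rightarrow> nat \<Rightarrow> real" where
  "dx_hat x W j = (W (j + 1) - W j) / half_step x j"

definition sx_hat :: "(nat \<Rightarrow> real) \<Rightarrow> (nat \<Rightarrow> real) \<Rightarrow> nat \<Rightarrow> real" where
  "sx_hat x W j =
     mesh_step x j / (2 * half_step x j) * W j +
     mesh_step x (j + 1) / (2 * half_step x j) * W (j + 1)"

definition C_op ::
  "(nat \<Rightarrow> real) \<Rightarrow> real \<Rightarrow> (nat \<Rightarrow> real) \<Rightarrow> (nat \<Rightarrow> real) \<Rightarrow> nat \<Rightarrow> real" where
  "C_op x \<theta> \<kappa> W j =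
     \<theta> * (mesh_step x j / half_step x j) * \<kappa> j * W (j - 1) +
     (1 - 2 * \<theta>) * sx_hat x \<kappa> j * W j +
     \<theta> * (mesh_step x (j + 1) / half_step x j) * \<kappa> (j + 1) * W (j + 1)"

definition s_minus :: "real \<Rightarrow> (nat \<Rightarrow> real) \<Rightarrow> nat \<Rightarrow> real" where
  "s_minus \<theta> W J = \<theta> * W (J - 1) + (1 / 2 - \<theta>) * W J"

definition A_op ::
  "(nat \<Rightarrow> real) \<Rightarrow> real \<Rightarrow> (nat \<Rightarrow> real) \<Rightarrow> (nat \<Rightarrow> real) \<Rightarrow> (nat \<Rightarrow> real) \<Rightarrow> nat \<Rightarrow> real" where
  "A_op x \<theta> b\<^sub>h c\<^sub>h W j = - dx_hat x (\<lambda>i. b\<^sub>h i * dx_back x W i) j + C_op x \<theta> c\<^sub>h W j"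

definition dt_back :: "(nat \<Rightarrow> real) \<Rightarrow> (nat \<Rightarrow> nat \<Rightarrow> real) \<Rightarrow> nat \<Rightarrow> nat \<Rightarrow> real" where
  "dt_back t U m j = (U m j - U (m - 1) j) / mesh_step t m"

definition time_avg :: "real \<Rightarrow> (nat \<Rightarrow> real) \<Rightarrow> nat \<Rightarrow> real" where
  "time_avg \<sigma> \<Phi> m = \<sigma> * \<Phi> m + (1 - \<sigma>) * \<Phi> (m - 1)"

definition avg :: "real \<Rightarrow> (nat \<Rightarrow> nat \<Rightarrow> real) \<Rightarrow> nat \<Rightarrow> nat \<Rightarrow> real" where
  "avg \<sigma> U m j = time_avg \<sigma> (\<lambda>k. U k j) m"

definition ip_\<omega> :: "(nat \<Rightarrow> real) \<Rightarrow> nat \<Rightarrow> (nat \<Rightarrow> real) \<Rightarrow> (nat \<Rightarrow> real) \<Rightarrow> real" where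
  "ip_\<omega> x J V W = (\<Sum>j = 1..<J. V j * W j * half_step x j)"

definition norm_\<omega> :: "(nat \<Rightarrow> real) \<Rightarrow> nat \<Rightarrow> (nat \<Rightarrow> real) \<Rightarrow> real" where
  "norm_\<omega> x J W = sqrt (ip_\<omega> x J W W)"

definition ip_tilde :: "(nat \<Rightarrow> real) \<Rightarrow> nat \<Rightarrow> (nat \<Rightarrow> real) \<Rightarrow> (nat \<Rightarrow> real) \<Rightarrow> real" where
  "ip_tilde x J V W = (\<Sum>j = 1..J. V j * W j * mesh_step x j)"

definition norm_tilde :: "(nat \<Rightarrow> real) \<Rightarrow> nat \<Rightarrow> (nat \<Rightarrow> real) \<Rightarrow> real" where
  "norm_tilde x J W = sqrt (ip_tilde x J W W)"

definition ip_C ::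
  "(nat \<Rightarrow> real) \<Rightarrow> nat \<Rightarrow> real \<Rightarrow> (nat \<Rightarrow> real) \<Rightarrow> (nat \<Rightarrow> real) \<Rightarrow> (nat \<Rightarrow> real) \<Rightarrow> real" where
  "ip_C x J \<theta> \<kappa> U W =
     ip_\<omega> x J (C_op x \<theta> \<kappa> U) W + \<kappa> J * s_minus \<theta> U J * W J * mesh_step x J"

(* The radicand is nonnegative for nonnegative coefficients, theta at most 1/4 and W 0 = 0. *)
definition norm_C ::
  "(nat \<Rightarrow> real) \<Rightarrow> nat \<Rightarrow> real \<Rightarrow> (nat \<Rightarrow> real) \<Rightarrow> (nat \<Rightarrow> real) \<Rightarrow> real" where
  "norm_C x J \<theta> \<kappa> W = sqrt (ip_C x J \<theta> \<kappa> W W)"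

definition norm_time :: "(nat \<Rightarrow> real) \<Rightarrow> nat \<Rightarrow> (nat \<Rightarrow> real) \<Rightarrow> real" where
  "norm_time t M \<Phi> = sqrt (\<Sum>m = 1..M. (\<Phi> m)\<^sup>2 * mesh_step t m)"

definition norm_space_time ::
  "(nat \<Rightarrow> real) \<Rightarrow> nat \<Rightarrow> (nat \<Rightarrow> real) \<Rightarrow> nat \<Rightarrow> (nat \<Rightarrow> nat \<Rightarrow> real) \<Rightarrow> real" where
  "norm_space_time x J t M V =
     sqrt (\<Sum>m = 1..M. (norm_tilde x J (V m))\<^sup>2 * mesh_step t m)"

definition energy_norm ::
  "(nat \<Rightarrow> real) \<Rightarrow> nat \<Rightarrow> (nat \<Rightarrow> real) \<Rightarrow> real \<Rightarrow> real \<Rightarrow>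
   (nat \<Rightarrow> real) \<Rightarrow> (nat \<Rightarrow> real) \<Rightarrow> (nat \<Rightarrow> real) \<Rightarrow> nat \<Rightarrow> (nat \<Rightarrow> nat \<Rightarrow> real) \<Rightarrow> real" where
  "energy_norm x J t \<sigma> \<theta> \<rho>\<^sub>h b\<^sub>h c\<^sub>h M U = sqrt (
     (\<sigma> - 1 / 2) *
       (\<Sum>m = 1..M. mesh_step t m * (norm_C x J \<theta> \<rho>\<^sub>h (dt_back t U m))\<^sup>2 * mesh_step t m) +
     (norm_space_time x J t M (\<lambda>m j. sqrt (b\<^sub>h j) * dx_back x (avg \<sigma> U m) j))\<^sup>2 +
     (\<Sum>m = 1..M. (norm_C x J \<theta> c\<^sub>h (avg \<sigma> U m))\<^sup>2 * mesh_step t m))"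

definition K_const :: "real \<Rightarrow> real" where
  "K_const \<sigma> = 2 * (\<sigma> + \<bar>1 - \<sigma>\<bar>)"

definition c_const :: "real \<Rightarrow> real" where
  "c_const \<theta> = 1 - 4 * max \<theta> 0"

(* A linear functional of the finite sequence Phi 0, ..., Phi m: sequences are total functions,
   so the first conjunct says that the later terms are not used. *)
definition linear_on_history :: "nat \<Rightarrow> ((nat \<Rightarrow> real) \<Rightarrow> real) \<Rightarrow> bool" where
  "linear_on_history m L \<longleftrightarrow>
     (\<forall>\<Phi> \<Psi>. (\<forall>k\<le>m. \<Phi> k = \<Psi> k) \<longrightarrow> L \<Phi> = L \<Psi>) \<and>
     (\<forall>\<Phi> \<Psi>. L (\<lambda>k. \<Phi> k + \<Psi> k) = L \<Phi> + L \<Psi>) \<and>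
     (\<forall>a \<Phi>. L (\<lambda>k. a * \<Phi> k) = a * L \<Phi>)"

definition scheme_solution ::
  "(nat \<Rightarrow> real) \<Rightarrow> nat \<Rightarrow> (nat \<Rightarrow> real) \<Rightarrow> real \<Rightarrow> real \<Rightarrow>
   (nat \<Rightarrow> real) \<Rightarrow> (nat \<Rightarrow> real) \<Rightarrow> (nat \<Rightarrow> real) \<Rightarrow> real \<Rightarrow> real \<Rightarrow> real \<Rightarrow>
   (nat \<Rightarrow> (nat \<Rightarrow> real) \<Rightarrow> real) \<Rightarrow>
   (nat \<Rightarrow> nat \<Rightarrow> real) \<Rightarrow> (nat \<Rightarrow> real) \<Rightarrow> (nat \<Rightarrow> real) \<Rightarrow> (nat \<Rightarrow> nat \<Rightarrow> real) \<Rightarrow> bool" where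
  "scheme_solution x J t \<sigma> \<theta> \<rho>\<^sub>h b\<^sub>h c\<^sub>h \<rho>_inf b_inf c_inf S F G U\<^sub>0 U \<longleftrightarrow>
     (\<forall>m\<ge>1. \<forall>j\<in>{1..<J}.
        C_op x \<theta> \<rho>\<^sub>h (dt_back t U m) j + A_op x \<theta> b\<^sub>h c\<^sub>h (avg \<sigma> U m) j = F m j) \<and>
     (\<forall>m\<ge>1. U m 0 = 0) \<and>
     (\<forall>j\<le>J. U 0 j = U\<^sub>0 j) \<and>
     (\<forall>m\<ge>1.
        b_inf * dx_back x (avg \<sigma> U m) J +
        mesh_step x J * s_minus \<theta> (\<lambda>j. \<rho>_inf * dt_back t U m j + c_inf * avg \<sigma> U m j) J
        = b_inf * S m (\<lambda>k. U k J) + G m)"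

end

theory Submission
  imports Defs "HOL-Analysis.L2_Norm"
begin

text \<open>The bound is an energy estimate. Pair the scheme at level \<open>m\<close> with \<open>W = avg \<sigma> U m\<close>: the boundary equation
cancels the terms that summation by parts leaves at the last node, and what remains
(\<open>residual_pairing\<close>) is
\[ (\bar\partial_t U^m, W)_{C_\theta[\rho_h]} + (b_h\bar\partial_x W, \bar\partial_x W)_{\widetilde\omega_h}
   + (W, W)_{C_\theta[c_h]} = (F^m, W)_{\omega_h} + (b_\infty \mathcal S^m U_J + G^m) W_J . \]
The first term is a difference quotient of half the squared norm of \<open>U\<close> plus a multiple
\<open>\<sigma> - 1/2\<close> of a square, because
\<open>avg \<sigma> U m\<close> is the mean of two levels shifted by \<open>(\<sigma> - 1/2) \<tau> m\<close> times the difference quotient.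
Summing over the levels telescopes, and the dissipativity hypothesis discards the operator
\<open>S\<close> (\<open>energy_inequality\<close>).

Let \<open>Y\<close> be the largest of the norms of \<open>U\<close> and \<open>E\<close> the energy norm. The data are paired as follows.
The part \<open>F1\<close> is moved onto the difference quotient of \<open>W\<close>, and \<open>G\<close> meets the end value of \<open>W\<close>, which the
difference quotient controls with the constant \<open>sqrt X\<close>; both are thus bounded by a multiple of \<open>E\<close>.
The part \<open>F0\<close> is bounded by a multiple of \<open>Y\<close>, since the form of \<open>\<rho>\<close> dominates
\<open>c_const \<theta> * \<rho>\<^sub>l\<close> times the square of the plain mesh norm. With \<open>N = max Y (sqrt 2 * E)\<close> this
gives \<open>N\<^sup>2 \<le> a\<^sup>2 + P N + Q N\<close> with \<open>a \<le> N\<close> the initial norm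
and \<open>P\<close>, \<open>Q\<close> the other two summands of the claimed bound, and dividing by \<open>N\<close> gives the claim (\<open>stability_bound\<close>).

For solvability, one time step is a square linear system for the \<open>J\<close> nodal values of the new level. The energy
inequality for a mesh function that is nonzero at a single level shows that its kernel is trivial
(\<open>step_injective\<close>), even for \<open>\<theta> = 1/4\<close>, where the form of \<open>\<rho>\<close> no
longer dominates the plain norm: there the term with \<open>b\<close> is used. Hence each step is uniquely solvable.\<close>

section \<open>Square linear systems with trivial kernel\<close>

text \<open>Gaussian elimination without matrices: some equation \<open>b\<close> involves the unknown \<open>a\<close>; using it to eliminate
that unknown leaves a smaller system, again with trivial kernel. Unknowns are functions
that vanish off a finite set \<open>A\<close>, so that the elimination stays in the same function type.\<close>

lemma injective_linear_system_solvable: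
  fixes L :: "('a \<Rightarrow> real) \<Rightarrow> 'b \<Rightarrow> real"
  assumes "finite A" "finite B" "card A = card B"
    and "\<And>u v i. L (\<lambda>k. u k + v k) i = L u i + L v i"
    and "\<And>r u i. L (\<lambda>k. r * u k) i = r * L u i"
    and "\<And>u. (\<And>k. k \<notin> A \<Longrightarrow> u k = 0) \<Longrightarrow> (\<And>i. i \<in> B \<Longrightarrow> L u i = 0) \<Longrightarrow> (\<And>k. u k = 0)"
  shows "\<exists>u. (\<forall>k. k \<notin> A \<longrightarrow> u k = 0) \<and> (\<forall>i\<in>B. L u i = f i)"
  using assms
proof (induction A arbitrary: B L f rule: finite_induct)
  case empty
  then have "B = {}" by simp
  then show ?case by (intro exI[of _ "\<lambda>_. 0"]) auto
next
  case (insert a A)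
  note add = insert.prems(3) and hom = insert.prems(4) and inj = insert.prems(5)
  define e :: "'a \<Rightarrow> real" where "e k = (if k = a then 1 else 0)" for k
  have "\<exists>b\<in>B. L e b \<noteq> 0"
  proof (rule ccontr)
    assume none: "\<not> (\<exists>b\<in>B. L e b \<noteq> 0)"
    have "e a = 0"
    proof (rule inj)
      show "e k = 0" if "k \<notin> insert a A" for k using that by (auto simp: e_def)
      show "L e i = 0" if "i \<in> B" for i using that none by blast
    qed
    then show False by (simp add: e_def)
  qed
  then obtain b where b: "b \<in> B" "L e b \<noteq> 0" by blast
  \<comment> \<open>The correction of \<open>u\<close> at the unknown \<open>a\<close> that makes equation \<open>b\<close> homogeneous.\<close>
  define P where "P u = (\<lambda>k. u k + (- (L u b / L e b)) * e k)" for u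
  have L_P: "L (P u) i = L u i - L u b / L e b * L e i" for u i
    unfolding P_def by (simp only: add hom)
  have card: "card A = card (B - {b})"
    using insert.prems(1,2) insert.hyps b(1) by simp
  have "\<exists>u. (\<forall>k. k \<notin> A \<longrightarrow> u k = 0) \<and> (\<forall>i\<in>B - {b}. L (P u) i = f i - f b / L e b * L e i)"
  proof (rule insert.IH)
    show "finite (B - {b})" using insert.prems(1) by simp
    show "card A = card (B - {b})" by (fact card)
    show "L (P (\<lambda>k. u k + v k)) i = L (P u) i + L (P v) i" for u v i
      unfolding L_P by (simp only: add) (simp add: add_divide_distrib algebra_simps)
    show "L (P (\<lambda>k. r * u k)) i = r * L (P u) i" for r u i
      unfolding L_P by (simp only: hom) (simp add: algebra_simps)
    show "u k = 0" if u: "\<And>k. k \<notin> A \<Longrightarrow> u k = 0"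
      and zero: "\<And>i. i \<in> B - {b} \<Longrightarrow> L (P u) i = 0" for u k
    proof -
      have P0: "P u k = 0" for k
      proof (rule inj)
        show "P u k = 0" if "k \<notin> insert a A" for k
          using that u by (simp add: P_def e_def)
        show "L (P u) i = 0" if "i \<in> B" for i
          using that zero[of i] b(2) by (cases "i = b") (auto simp: L_P)
      qed
      show ?thesis
      proof (cases "k = a")
        case True
        then show ?thesis using u insert.hyps by simp
      next
        case False
        then show ?thesis using P0[of k] by (simp add: P_def e_def)
      qed
    qed
  qed
  then obtain u where u: "\<And>k. k \<notin> A \<Longrightarrow> u k = 0"
    and Lu: "\<And>i. i \<in> B - {b} \<Longrightarrow> L (P u) i = f i - f b / L e b * L e i" by blast
  define v where "v = (\<lambda>k. P u k + f b / L e b * e k)"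
  have Lv: "L v i = L (P u) i + f b / L e b * L e i" for i
    unfolding v_def by (simp only: add hom)
  have "L v i = f i" if "i \<in> B" for i
    using that Lu[of i] b(2) by (cases "i = b") (auto simp: Lv L_P)
  moreover have "v k = 0" if "k \<notin> insert a A" for k
    using that u by (simp add: v_def P_def e_def)
  ultimately show ?case by blast
qed

section \<open>Mesh inner products\<close>

lemma sum_Cauchy_Schwarz_weighted:
  fixes f g w :: "'a \<Rightarrow> real"
  assumes "\<And>i. i \<in> A \<Longrightarrow> w i \<ge> 0"
  shows "\<bar>\<Sum>i\<in>A. f i * g i * w i\<bar> \<le> sqrt (\<Sum>i\<in>A. (f i)\<^sup>2 * w i) * sqrt (\<Sum>i\<in>A. (g i)\<^sup>2 * w i)"
proof -
  have "\<bar>\<Sum>i\<in>A. f i * g i * w i\<bar> \<le> (\<Sum>i\<in>A. \<bar>f i * g i * w i\<bar>)" by (rule sum_abs)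
  also have "\<dots> = (\<Sum>i\<in>A. \<bar>f i * sqrt (w i)\<bar> * \<bar>g i * sqrt (w i)\<bar>)"
    using assms by (intro sum.cong) (auto simp: abs_mult algebra_simps)
  also have "\<dots> \<le> L2_set (\<lambda>i. f i * sqrt (w i)) A * L2_set (\<lambda>i. g i * sqrt (w i)) A"
    by (rule L2_set_mult_ineq)
  also have "\<dots> = sqrt (\<Sum>i\<in>A. (f i)\<^sup>2 * w i) * sqrt (\<Sum>i\<in>A. (g i)\<^sup>2 * w i)"
    using assms by (simp add: L2_set_def power_mult_distrib cong: sum.cong)
  finally show ?thesis .
qed

lemma mesh_step_pos: "strict_mono x \<Longrightarrow> j \<ge> 1 \<Longrightarrow> mesh_step x j > 0"
  by (simp add: mesh_step_def strict_mono_less)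

lemma half_step_pos: "strict_mono x \<Longrightarrow> j \<ge> 1 \<Longrightarrow> half_step x j > 0"
  using mesh_step_pos[of x j] mesh_step_pos[of x "j + 1"] by (simp add: half_step_def)

text \<open>The value at the last node is the only boundary term, as \<open>W\<close> vanishes at the first one. It is this term that the
boundary equation of the scheme replaces by data.\<close>

lemma summation_by_parts:
  assumes x: "strict_mono x" and W: "W 0 = 0" and J: "J \<ge> 1"
  shows "ip_\<omega> x J (dx_hat x V) W = V J * W J - ip_tilde x J V (dx_back x W)"
  using J
proof (induction J rule: dec_induct)
  case base
  show ?case using W mesh_step_pos[OF x, of 1] by (simp add: ip_\<omega>_def ip_tilde_def dx_back_def)
next
  case (step n)
  have "ip_\<omega> x (Suc n) (dx_hat x V) W = ip_\<omega> x n (dx_hat x V) W + (V (Suc n) - V n) * W n"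
    using step.hyps half_step_pos[OF x, of n] by (simp add: ip_\<omega>_def dx_hat_def)
  moreover have "ip_tilde x (Suc n) V (dx_back x W)
      = ip_tilde x n V (dx_back x W) + V (Suc n) * (W (Suc n) - W n)"
    using mesh_step_pos[OF x, of "Suc n"] by (simp add: ip_tilde_def dx_back_def)
  ultimately show ?case using step.IH by (simp add: algebra_simps)
qed

text \<open>The nodal sum with the correction at the last node regroups into one contribution per mesh cell: every interior node gets
a half from each adjacent cell, and the correction supplies the half that the last node
gets from its only cell. In this form symmetry is visible and positivity is a question about
two adjacent nodal values.\<close>

lemma ip_C_cellwise:
  assumes x: "strict_mono x" and J: "J \<ge> 1" and U: "U 0 = 0" and W: "W 0 = 0"
  shows "ip_C x J \<theta> \<kappa> U W = (\<Sum>j = 1..J. \<kappa> j * mesh_step x j *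
    (\<theta> * (U (j - 1) * W j + U j * W (j - 1)) + (1 / 2 - \<theta>) * (U j * W j + U (j - 1) * W (j - 1))))"
  using J
proof (induction J rule: dec_induct)
  case base
  show ?case using U W by (simp add: ip_C_def ip_\<omega>_def s_minus_def algebra_simps)
next
  case (step n)
  have node: "C_op x \<theta> \<kappa> U n * half_step x n =
      \<theta> * mesh_step x n * \<kappa> n * U (n - 1)
      + (1 - 2 * \<theta>) / 2 * (mesh_step x n * \<kappa> n + mesh_step x (n + 1) * \<kappa> (n + 1)) * U n
      + \<theta> * mesh_step x (n + 1) * \<kappa> (n + 1) * U (n + 1)"
    using half_step_pos[OF x, of n] step.hyps
    by (simp add: C_op_def sx_hat_def field_simps)
  have "ip_C x (Suc n) \<theta> \<kappa> U W = ip_C x n \<theta> \<kappa> U W - \<kappa> n * s_minus \<theta> U n * W n * mesh_step x n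
      + (C_op x \<theta> \<kappa> U n * half_step x n) * W n
      + \<kappa> (Suc n) * s_minus \<theta> U (Suc n) * W (Suc n) * mesh_step x (Suc n)"
    using step.hyps by (simp add: ip_C_def ip_\<omega>_def)
  then show ?case unfolding node using step.IH
    by (simp add: s_minus_def field_simps)
qed

lemma ip_C_sym:
  assumes "strict_mono x" "J \<ge> 1" "U 0 = 0" "W 0 = 0"
  shows "ip_C x J \<theta> \<kappa> U W = ip_C x J \<theta> \<kappa> W U"
  using assms by (simp add: ip_C_cellwise algebra_simps)

lemma C_op_linear:
  "C_op x \<theta> \<kappa> (\<lambda>j. r * U j + s * V j) j = r * C_op x \<theta> \<kappa> U j + s * C_op x \<theta> \<kappa> V j"
  by (simp add: C_op_def algebra_simps add_divide_distrib)

lemma ip_C_linear_left: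
  "ip_C x J \<theta> \<kappa> (\<lambda>j. r * U j + s * V j) W = r * ip_C x J \<theta> \<kappa> U W + s * ip_C x J \<theta> \<kappa> V W"
proof -
  have "ip_\<omega> x J (C_op x \<theta> \<kappa> (\<lambda>j. r * U j + s * V j)) W
      = r * ip_\<omega> x J (C_op x \<theta> \<kappa> U) W + s * ip_\<omega> x J (C_op x \<theta> \<kappa> V) W"
    by (simp add: ip_\<omega>_def C_op_linear sum_distrib_left distrib_right sum.distrib mult.assoc)
  then show ?thesis by (simp add: ip_C_def s_minus_def algebra_simps)
qed

lemma ip_C_linear_right:
  "ip_C x J \<theta> \<kappa> W (\<lambda>j. r * U j + s * V j) = r * ip_C x J \<theta> \<kappa> W U + s * ip_C x J \<theta> \<kappa> W V"
proof -
  have "ip_\<omega> x J Z (\<lambda>j. r * U j + s * V j) = r * ip_\<omega> x J Z U + s * ip_\<omega> x J Z V" for Z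
    by (simp add: ip_\<omega>_def sum_distrib_left distrib_left distrib_right sum.distrib mult_ac)
  then show ?thesis by (simp add: ip_C_def algebra_simps)
qed

text \<open>The left-hand form is \<open>(a\<^sup>2 + b\<^sup>2) / 2 - \<theta> (a - b)\<^sup>2\<close>, and
\<open>(a - b)\<^sup>2 \<le> 2 (a\<^sup>2 + b\<^sup>2)\<close>; for negative \<open>\<theta>\<close> the last term helps, whence
the positive part of \<open>\<theta>\<close> in the constant.\<close>

lemma cell_form_lower_bound:
  fixes a b \<theta> :: real
  assumes "\<theta> \<le> 1 / 4"
  shows "\<theta> * (a * b + b * a) + (1 / 2 - \<theta>) * (b * b + a * a) \<ge> c_const \<theta> / 2 * (a\<^sup>2 + b\<^sup>2)"
proof -
  have "\<theta> * (a - b)\<^sup>2 \<le> max \<theta> 0 * (a - b)\<^sup>2" by (intro mult_right_mono) auto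
  also have "\<dots> \<le> max \<theta> 0 * (2 * (a\<^sup>2 + b\<^sup>2))"
  proof (intro mult_left_mono)
    have "2 * (a\<^sup>2 + b\<^sup>2) - (a - b)\<^sup>2 = (a + b)\<^sup>2" by (simp add: power2_eq_square algebra_simps)
    then show "(a - b)\<^sup>2 \<le> 2 * (a\<^sup>2 + b\<^sup>2)" by (metis diff_ge_0_iff_ge zero_le_power2)
  qed simp
  finally show ?thesis
    by (simp add: c_const_def power2_eq_square field_simps)
qed

lemma c_const_nonneg: "\<theta> \<le> 1 / 4 \<Longrightarrow> c_const \<theta> \<ge> 0"
  and c_const_pos: "\<theta> < 1 / 4 \<Longrightarrow> c_const \<theta> > 0"
  by (auto simp: c_const_def max_def)

lemma ip_C_lower_bound:
  assumes x: "strict_mono x" and J: "J \<ge> 1" and W: "W 0 = 0" and \<theta>: "\<theta> \<le> 1 / 4"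
    and k: "k \<ge> 0" "\<And>j. j \<in> {1..J} \<Longrightarrow> \<kappa> j \<ge> k"
  shows "ip_C x J \<theta> \<kappa> W W \<ge> c_const \<theta> * k * ip_\<omega> x J W W"
proof -
  \<comment> \<open>Regrouped by nodes, the trapezoidal sum is the plain squared norm plus half a cell at the end.\<close>
  have "(\<Sum>j = 1..J. mesh_step x j / 2 * ((W (j - 1))\<^sup>2 + (W j)\<^sup>2))
      = ip_\<omega> x J W W + mesh_step x J / 2 * (W J)\<^sup>2"
    using J
  proof (induction J rule: dec_induct)
    case base
    then show ?case using W by (simp add: ip_\<omega>_def)
  next
    case (step n)
    then show ?case by (simp add: ip_\<omega>_def half_step_def field_simps power2_eq_square)
  qed
  then have "ip_\<omega> x J W W \<le> (\<Sum>j = 1..J. mesh_step x j / 2 * ((W (j - 1))\<^sup>2 + (W j)\<^sup>2))"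
    using mesh_step_pos[OF x J] by simp
  then have "c_const \<theta> * k * ip_\<omega> x J W W
      \<le> c_const \<theta> * k * (\<Sum>j = 1..J. mesh_step x j / 2 * ((W (j - 1))\<^sup>2 + (W j)\<^sup>2))"
    using c_const_nonneg[OF \<theta>] k(1) by (intro mult_left_mono) auto
  also have "\<dots> = (\<Sum>j = 1..J. k * mesh_step x j * (c_const \<theta> / 2 * ((W (j - 1))\<^sup>2 + (W j)\<^sup>2)))"
    by (simp add: sum_distrib_left mult_ac)
  also have "\<dots> \<le> (\<Sum>j = 1..J. \<kappa> j * mesh_step x j *
    (\<theta> * (W (j - 1) * W j + W j * W (j - 1)) + (1 / 2 - \<theta>) * (W j * W j + W (j - 1) * W (j - 1))))"
    using k mesh_step_pos[OF x] c_const_nonneg[OF \<theta>]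
    by (intro sum_mono mult_mono cell_form_lower_bound[OF \<theta>] mult_nonneg_nonneg)
       (auto simp: less_imp_le intro: order_trans)
  finally show ?thesis by (simp add: ip_C_cellwise[OF x J, of W W, OF W W])
qed

lemma ip_C_nonneg:
  assumes "strict_mono x" "J \<ge> 1" "W 0 = 0" "\<theta> \<le> 1 / 4" "\<And>j. j \<in> {1..J} \<Longrightarrow> \<kappa> j \<ge> 0"
  shows "ip_C x J \<theta> \<kappa> W W \<ge> 0"
  using ip_C_lower_bound[where k = 0 and W = W, OF assms(1-4) _ assms(5)] by simp

lemma norm_C_cong:
  assumes "\<And>j. j \<le> J \<Longrightarrow> U j = V j"
  shows "norm_C x J \<theta> \<kappa> U = norm_C x J \<theta> \<kappa> V"
proof -
  have "ip_\<omega> x J (C_op x \<theta> \<kappa> U) U = ip_\<omega> x J (C_op x \<theta> \<kappa> V) V"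
    unfolding ip_\<omega>_def C_op_def using assms by (intro sum.cong) auto
  then show ?thesis using assms by (simp add: norm_C_def ip_C_def s_minus_def)
qed

section \<open>The energy identity\<close>

text \<open>Dividing a quadratic energy inequality by \<open>N\<close>: \<open>y\<close> and \<open>e\<close> stand for the two norms
whose maximum is \<open>N\<close>.\<close>

lemma le_of_energy_inequalities:
  fixes N a P Q y e :: real
  assumes "N = y \<or> N = e" "y\<^sup>2 \<le> R" "e\<^sup>2 \<le> R" "0 \<le> N" "0 \<le> P" "0 \<le> Q" "0 \<le> a"
    "R \<le> a\<^sup>2 + P * N + Q * N"  "a \<le> N"
  shows "N \<le> a + P + Q"
proof (rule ccontr)
  assume neg: "\<not> N \<le> a + P + Q"
  have "N * N \<le> a * a + P * N + Q * N" using assms by (auto simp: power2_eq_square)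
  also have "\<dots> \<le> (a + P + Q) * N" using assms mult_left_mono[of a N a] by (simp add: algebra_simps)
  also have "\<dots> < N * N" using neg assms by (intro mult_strict_right_mono) auto
  finally show False by simp
qed

text \<open>The coefficients here are the mesh values; those at the last cell also serve as the constants of the boundary equation.\<close>

locale dissipative_scheme =
  fixes x t :: "nat \<Rightarrow> real" and J :: nat and \<rho> b c :: "nat \<Rightarrow> real"
    and S :: "nat \<Rightarrow> (nat \<Rightarrow> real) \<Rightarrow> real" and \<sigma> \<theta> \<rho>\<^sub>l \<nu> :: real
  assumes x_mono: "strict_mono x" and x_0: "x 0 = 0" and t_mono: "strict_mono t"
    and J_pos: "J \<ge> 1"
    and \<rho>\<^sub>l_pos: "\<rho>\<^sub>l > 0" and \<rho>_ge: "\<And>j. j \<in> {1..J} \<Longrightarrow> \<rho> j \<ge> \<rho>\<^sub>l"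
    and \<nu>_pos: "\<nu> > 0" and b_ge: "\<And>j. j \<in> {1..J} \<Longrightarrow> b j \<ge> \<nu>"
    and c_ge: "\<And>j. j \<in> {1..J} \<Longrightarrow> c j \<ge> 0"
    and S_linear: "\<And>m. m \<ge> 1 \<Longrightarrow> linear_on_history m (S m)"
    and S_dissipative: "\<And>M \<Phi>. M \<ge> 1 \<Longrightarrow> \<Phi> 0 = 0 \<Longrightarrow>
      (\<Sum>m = 1..M. S m \<Phi> * time_avg \<sigma> \<Phi> m * mesh_step t m) \<le> 0"
    and \<sigma>_ge: "\<sigma> \<ge> 1 / 2" and \<theta>_le: "\<theta> \<le> 1 / 4"
begin

abbreviation \<tau> :: "nat \<Rightarrow> real" where "\<tau> \<equiv> mesh_step t"

abbreviation h :: "nat \<Rightarrow> real" where "h \<equiv> mesh_step x"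

text \<open>The left-hand sides of the scheme at a level, with the boundary equation (including the operator \<open>S\<close>)
placed at the node \<open>J\<close>. It is linear in the whole mesh
function, history included; this makes each time step a linear system in the newest level.\<close>

definition residual :: "(nat \<Rightarrow> nat \<Rightarrow> real) \<Rightarrow> nat \<Rightarrow> nat \<Rightarrow> real" where
  "residual U m j =
     (if j < J then C_op x \<theta> \<rho> (dt_back t U m) j + A_op x \<theta> b c (avg \<sigma> U m) j
      else b J * dx_back x (avg \<sigma> U m) J
        + h J * s_minus \<theta> (\<lambda>j. \<rho> J * dt_back t U m j + c J * avg \<sigma> U m j) J
        - b J * S m (\<lambda>k. U k J))"

lemma scheme_solution_iff_residual:
  "scheme_solution x J t \<sigma> \<theta> \<rho> b c (\<rho> J) (b J) (c J) S F G U\<^sub>0 U \<longleftrightarrow>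
    (\<forall>m\<ge>1. \<forall>j\<in>{1..J}. residual U m j = (if j < J then F m j else G m)) \<and>
    (\<forall>m\<ge>1. U m 0 = 0) \<and> (\<forall>j\<le>J. U 0 j = U\<^sub>0 j)"
proof -
  have nodes: "{1..J} = insert J {1..<J}" using J_pos by auto
  show ?thesis
    unfolding scheme_solution_def residual_def nodes by (auto simp: algebra_simps)
qed

lemma S_add: "m \<ge> 1 \<Longrightarrow> S m (\<lambda>k. \<Phi> k + \<Psi> k) = S m \<Phi> + S m \<Psi>"
  and S_scale: "m \<ge> 1 \<Longrightarrow> S m (\<lambda>k. r * \<Phi> k) = r * S m \<Phi>"
  and S_cong: "m \<ge> 1 \<Longrightarrow> (\<And>k. k \<le> m \<Longrightarrow> \<Phi> k = \<Psi> k) \<Longrightarrow> S m \<Phi> = S m \<Psi>"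
  using S_linear unfolding linear_on_history_def by blast+

lemma \<tau>_pos: "m \<ge> 1 \<Longrightarrow> \<tau> m > 0" and h_pos: "j \<ge> 1 \<Longrightarrow> h j > 0"
  using mesh_step_pos t_mono x_mono by blast+

lemma residual_linear:
  assumes m: "m \<ge> 1"
  shows "residual (\<lambda>k j. r * U k j + s * V k j) m j = r * residual U m j + s * residual V m j"
proof -
  let ?W = "\<lambda>k j. r * U k j + s * V k j"
  have dt: "dt_back t ?W m = (\<lambda>j. r * dt_back t U m j + s * dt_back t V m j)"
    by (auto simp: dt_back_def algebra_simps add_divide_distrib diff_divide_distrib)
  have av: "avg \<sigma> ?W m = (\<lambda>j. r * avg \<sigma> U m j + s * avg \<sigma> V m j)"
    by (auto simp: avg_def time_avg_def algebra_simps)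
  have dx: "dx_back x (\<lambda>j. r * p j + s * q j) = (\<lambda>j. r * dx_back x p j + s * dx_back x q j)" for p q
    by (auto simp: dx_back_def algebra_simps add_divide_distrib diff_divide_distrib)
  have A: "A_op x \<theta> b c (\<lambda>j. r * p j + s * q j) j = r * A_op x \<theta> b c p j + s * A_op x \<theta> b c q j"
    for p q j
    unfolding A_op_def C_op_linear dx
    by (simp add: dx_hat_def algebra_simps add_divide_distrib diff_divide_distrib)
  have S: "S m (\<lambda>k. ?W k J) = r * S m (\<lambda>k. U k J) + s * S m (\<lambda>k. V k J)"
    using S_add[OF m, of "\<lambda>k. r * U k J" "\<lambda>k. s * V k J"] S_scale[OF m] by simp
  show ?thesis
    unfolding residual_def dt av S dx A C_op_linear by (auto simp: s_minus_def algebra_simps)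
qed

lemma residual_cong:
  assumes "m \<ge> 1" "j \<le> J" "\<And>k i. k \<le> m \<Longrightarrow> i \<le> J \<Longrightarrow> U k i = V k i"
  shows "residual U m j = residual V m j"
proof -
  have "S m (\<lambda>k. U k J) = S m (\<lambda>k. V k J)" using assms by (intro S_cong) auto
  then show ?thesis using assms
    by (auto simp: residual_def A_op_def C_op_def dx_hat_def dx_back_def dt_back_def avg_def
      time_avg_def s_minus_def)
qed

lemma residual_pairing:
  assumes W: "W 0 = 0"
  shows "ip_C x J \<theta> \<rho> (dt_back t U m) W
      + ip_tilde x J (\<lambda>j. b j * dx_back x (avg \<sigma> U m) j) (dx_back x W)
      + ip_C x J \<theta> c (avg \<sigma> U m) W
    = ip_\<omega> x J (residual U m) W + (residual U m J + b J * S m (\<lambda>k. U k J)) * W J"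
proof -
  let ?V = "\<lambda>j. b j * dx_back x (avg \<sigma> U m) j"
  have "ip_\<omega> x J (residual U m) W = ip_\<omega> x J (C_op x \<theta> \<rho> (dt_back t U m)) W
      - ip_\<omega> x J (dx_hat x ?V) W + ip_\<omega> x J (C_op x \<theta> c (avg \<sigma> U m)) W"
    by (simp add: ip_\<omega>_def residual_def A_op_def sum_subtractf[symmetric] sum.distrib[symmetric]
        algebra_simps)
  then show ?thesis
    unfolding summation_by_parts[where W = W, OF x_mono W J_pos]
    by (simp add: ip_C_def residual_def s_minus_def algebra_simps)
qed

text \<open>With \<open>p\<close>, \<open>q\<close> the new and old levels and \<open>B\<close> the symmetric form,
\<open>B (p - q) (\<sigma> p + (1 - \<sigma>) q) = (B p p - B q q) / 2 + (\<sigma> - 1/2) B (p - q) (p - q)\<close>.\<close>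

lemma ip_C_dt_avg:
  assumes m: "m \<ge> 1" and U: "U m 0 = 0" "U (m - 1) 0 = 0"
  shows "ip_C x J \<theta> \<rho> (dt_back t U m) (avg \<sigma> U m) * \<tau> m
    = ip_C x J \<theta> \<rho> (U m) (U m) / 2 - ip_C x J \<theta> \<rho> (U (m - 1)) (U (m - 1)) / 2
      + (\<sigma> - 1 / 2) * (\<tau> m * ip_C x J \<theta> \<rho> (dt_back t U m) (dt_back t U m) * \<tau> m)"
proof -
  let ?ip = "ip_C x J \<theta> \<rho>" and ?p = "U m" and ?q = "U (m - 1)"
  have dt: "dt_back t U m = (\<lambda>j. (1 / \<tau> m) * ?p j + (- 1 / \<tau> m) * ?q j)"
    by (auto simp: dt_back_def diff_divide_distrib)
  have av: "avg \<sigma> U m = (\<lambda>j. \<sigma> * ?p j + (1 - \<sigma>) * ?q j)"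
    by (auto simp: avg_def time_avg_def)
  have sym: "?ip ?q ?p = ?ip ?p ?q" using ip_C_sym[OF x_mono J_pos] U by blast
  show ?thesis using \<tau>_pos[OF m]
    unfolding dt av ip_C_linear_left ip_C_linear_right sym by (simp add: field_simps)
qed

text \<open>The square of the energy norm, written with the quadratic forms themselves so that sums over levels split
without square roots.\<close>

definition energy :: "nat \<Rightarrow> (nat \<Rightarrow> nat \<Rightarrow> real) \<Rightarrow> real" where
  "energy M U = (\<Sum>m = 1..M.
     (\<sigma> - 1 / 2) * (\<tau> m * ip_C x J \<theta> \<rho> (dt_back t U m) (dt_back t U m) * \<tau> m)
     + (\<Sum>j = 1..J. b j * (dx_back x (avg \<sigma> U m) j)\<^sup>2 * h j) * \<tau> m
     + ip_C x J \<theta> c (avg \<sigma> U m) (avg \<sigma> U m) * \<tau> m)"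

lemma energy_identity:
  assumes U: "\<And>m. U m 0 = 0"
  shows "ip_C x J \<theta> \<rho> (U M) (U M) / 2 + energy M U = ip_C x J \<theta> \<rho> (U 0) (U 0) / 2
    + (\<Sum>m = 1..M. ip_\<omega> x J (residual U m) (avg \<sigma> U m) * \<tau> m)
    + (\<Sum>m = 1..M. residual U m J * avg \<sigma> U m J * \<tau> m)
    + b J * (\<Sum>m = 1..M. S m (\<lambda>k. U k J) * time_avg \<sigma> (\<lambda>k. U k J) m * \<tau> m)"
proof (induction M)
  case 0
  show ?case by (simp add: energy_def)
next
  case (Suc M)
  let ?m = "Suc M"
  have av0: "avg \<sigma> U ?m 0 = 0" using U by (simp add: avg_def time_avg_def)
  have flux: "ip_tilde x J (\<lambda>j. b j * dx_back x (avg \<sigma> U ?m) j) (dx_back x (avg \<sigma> U ?m))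
      = (\<Sum>j = 1..J. b j * (dx_back x (avg \<sigma> U ?m) j)\<^sup>2 * h j)"
    by (simp add: ip_tilde_def power2_eq_square mult_ac)
  have "ip_C x J \<theta> \<rho> (dt_back t U ?m) (avg \<sigma> U ?m) * \<tau> ?m
      + (\<Sum>j = 1..J. b j * (dx_back x (avg \<sigma> U ?m) j)\<^sup>2 * h j) * \<tau> ?m
      + ip_C x J \<theta> c (avg \<sigma> U ?m) (avg \<sigma> U ?m) * \<tau> ?m
    = ip_\<omega> x J (residual U ?m) (avg \<sigma> U ?m) * \<tau> ?m + residual U ?m J * avg \<sigma> U ?m J * \<tau> ?m
      + b J * (S ?m (\<lambda>k. U k J) * time_avg \<sigma> (\<lambda>k. U k J) ?m * \<tau> ?m)"
    using arg_cong[OF residual_pairing[where U = U and m = ?m and W = "avg \<sigma> U ?m", OF av0, unfolded flux], of "\<lambda>z. z * \<tau> ?m"]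
    by (simp add: algebra_simps avg_def)
  moreover have "ip_C x J \<theta> \<rho> (dt_back t U ?m) (avg \<sigma> U ?m) * \<tau> ?m
    = ip_C x J \<theta> \<rho> (U ?m) (U ?m) / 2 - ip_C x J \<theta> \<rho> (U M) (U M) / 2
      + (\<sigma> - 1 / 2) * (\<tau> ?m * ip_C x J \<theta> \<rho> (dt_back t U ?m) (dt_back t U ?m) * \<tau> ?m)"
    using ip_C_dt_avg[of ?m U] U by simp
  ultimately show ?case using Suc.IH
    by (simp add: energy_def distrib_left)
qed

lemma b_pos: "j \<in> {1..J} \<Longrightarrow> b j > 0"
  using b_ge \<nu>_pos by force

lemma ip_\<rho>_nonneg: "W 0 = 0 \<Longrightarrow> ip_C x J \<theta> \<rho> W W \<ge> 0"
  using ip_C_nonneg[where W = W and \<kappa> = \<rho>, OF x_mono J_pos _ \<theta>_le] \<rho>_ge \<rho>\<^sub>l_pos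
  by (meson less_eq_real_def order_trans)

lemma ip_c_nonneg: "W 0 = 0 \<Longrightarrow> ip_C x J \<theta> c W W \<ge> 0"
  using ip_C_nonneg[where W = W and \<kappa> = c, OF x_mono J_pos _ \<theta>_le] c_ge by blast

lemma norm_\<rho>_sq: "W 0 = 0 \<Longrightarrow> (norm_C x J \<theta> \<rho> W)\<^sup>2 = ip_C x J \<theta> \<rho> W W"
  and norm_c_sq: "W 0 = 0 \<Longrightarrow> (norm_C x J \<theta> c W)\<^sup>2 = ip_C x J \<theta> c W W"
  by (simp_all add: norm_C_def ip_\<rho>_nonneg ip_c_nonneg)

lemma dt_back_0: "(\<And>m. U m 0 = 0) \<Longrightarrow> dt_back t U m 0 = 0"
  and avg_0: "(\<And>m. U m 0 = 0) \<Longrightarrow> avg \<sigma> U m 0 = 0"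
  by (simp_all add: dt_back_def avg_def time_avg_def)

lemma flux_nonneg: "(\<Sum>j = 1..J. b j * (V j)\<^sup>2 * h j) \<ge> 0"
  using b_pos h_pos by (intro sum_nonneg mult_nonneg_nonneg) (auto simp: less_imp_le)

lemma energy_mono:
  assumes U: "\<And>m. U m 0 = 0" and "L \<le> M"
  shows "energy L U \<le> energy M U"
  unfolding energy_def using assms \<tau>_pos \<sigma>_ge
  by (intro sum_mono2 add_nonneg_nonneg mult_nonneg_nonneg flux_nonneg ip_\<rho>_nonneg ip_c_nonneg
      dt_back_0 avg_0) (auto simp: less_imp_le)

lemma flux_norm_sq:
  "(norm_space_time x J t M (\<lambda>m j. sqrt (b j) * dx_back x (avg \<sigma> U m) j))\<^sup>2
    = (\<Sum>m = 1..M. (\<Sum>j = 1..J. b j * (dx_back x (avg \<sigma> U m) j)\<^sup>2 * h j) * \<tau> m)"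
proof -
  have "ip_tilde x J (\<lambda>j. sqrt (b j) * V j) (\<lambda>j. sqrt (b j) * V j)
      = (\<Sum>j = 1..J. b j * (V j)\<^sup>2 * h j)" for V
    unfolding ip_tilde_def
  proof (intro sum.cong refl)
    fix j assume "j \<in> {1..J}"
    then have "sqrt (b j) * sqrt (b j) = b j" using b_pos[of j] by simp
    then show "sqrt (b j) * V j * (sqrt (b j) * V j) * h j = b j * (V j)\<^sup>2 * h j"
      by (simp add: power2_eq_square mult_ac)
  qed
  then have "(norm_tilde x J (\<lambda>j. sqrt (b j) * V j))\<^sup>2 = (\<Sum>j = 1..J. b j * (V j)\<^sup>2 * h j)" for V
    using flux_nonneg by (simp add: norm_tilde_def)
  moreover have "(\<Sum>m = 1..M. (\<Sum>j = 1..J. b j * (dx_back x (avg \<sigma> U m) j)\<^sup>2 * h j) * \<tau> m) \<ge> 0"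
    using \<tau>_pos by (intro sum_nonneg mult_nonneg_nonneg flux_nonneg) (auto simp: less_imp_le)
  ultimately show ?thesis by (simp add: norm_space_time_def)
qed

lemma energy_norm_eq:
  assumes U: "\<And>m. U m 0 = 0"
  shows "energy_norm x J t \<sigma> \<theta> \<rho> b c M U = sqrt (energy M U)"
    and flux_norm_sq_le_energy: "(norm_space_time x J t M (\<lambda>m j. sqrt (b j) * dx_back x (avg \<sigma> U m) j))\<^sup>2 \<le> energy M U"
proof -
  let ?A = "\<Sum>m = 1..M. \<tau> m * (norm_C x J \<theta> \<rho> (dt_back t U m))\<^sup>2 * \<tau> m"
    and ?B = "(norm_space_time x J t M (\<lambda>m j. sqrt (b j) * dx_back x (avg \<sigma> U m) j))\<^sup>2"
    and ?C = "\<Sum>m = 1..M. (norm_C x J \<theta> c (avg \<sigma> U m))\<^sup>2 * \<tau> m"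
  have eq: "(\<sigma> - 1 / 2) * ?A + ?B + ?C = energy M U"
    using dt_back_0[of U, OF U] avg_0[of U, OF U]
    by (simp add: flux_norm_sq energy_def sum.distrib sum_distrib_left norm_\<rho>_sq norm_c_sq)
  have nonneg: "(\<sigma> - 1 / 2) * ?A \<ge> 0" "?B \<ge> 0" "?C \<ge> 0"
    using \<sigma>_ge \<tau>_pos by (auto intro!: mult_nonneg_nonneg sum_nonneg simp: less_imp_le)
  show "energy_norm x J t \<sigma> \<theta> \<rho> b c M U = sqrt (energy M U)"
    by (simp add: energy_norm_def eq[symmetric])
  show "?B \<le> energy M U" using eq nonneg by linarith
qed

lemma energy_nonneg: "(\<And>m. U m 0 = 0) \<Longrightarrow> energy M U \<ge> 0"
  using flux_norm_sq_le_energy[of U M] by (meson order_trans zero_le_power2)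

section \<open>The stability bound\<close>

lemma norm_tilde_nonneg: "norm_tilde x J W \<ge> 0"
  unfolding norm_tilde_def ip_tilde_def using h_pos
  by (intro real_sqrt_ge_zero sum_nonneg) (auto simp: less_imp_le)

lemma ip_tilde_Cauchy_Schwarz:
  "\<bar>ip_tilde x J V W\<bar> \<le> norm_tilde x J V * norm_tilde x J W"
  using sum_Cauchy_Schwarz_weighted[of "{1..J}" h V W] h_pos
  by (simp add: ip_tilde_def norm_tilde_def power2_eq_square less_imp_le)

lemma ip_\<omega>_Cauchy_Schwarz:
  "\<bar>ip_\<omega> x J V W\<bar> \<le> norm_\<omega> x J V * norm_\<omega> x J W"
  using sum_Cauchy_Schwarz_weighted[of "{1..<J}" "half_step x" V W] half_step_pos[OF x_mono]
  by (simp add: ip_\<omega>_def norm_\<omega>_def power2_eq_square less_imp_le)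

lemma ip_\<omega>_nonneg: "ip_\<omega> x J W W \<ge> 0"
  unfolding ip_\<omega>_def using half_step_pos[OF x_mono]
  by (intro sum_nonneg) (auto simp: less_imp_le)

text \<open>The end value is the sum of the increments, and the constant function one has norm \<open>sqrt (x J)\<close>.\<close>

lemma end_value_le_derivative_norm:
  assumes W: "W 0 = 0"
  shows "\<bar>W J\<bar> \<le> sqrt (x J) * norm_tilde x J (dx_back x W)"
proof -
  have tele: "(\<Sum>j = 1..J. V j - V (j - 1)) = V J - V 0" for V :: "nat \<Rightarrow> real"
    by (induction J) auto
  have "ip_tilde x J (dx_back x W) (\<lambda>_. 1) = (\<Sum>j = 1..J. W j - W (j - 1))"
    unfolding ip_tilde_def dx_back_def
    by (intro sum.cong) (use h_pos in \<open>auto simp: less_imp_neq[symmetric]\<close>)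
  then have "ip_tilde x J (dx_back x W) (\<lambda>_. 1) = W J" using tele[of W] W by simp
  moreover have "norm_tilde x J (\<lambda>_. 1) = sqrt (x J)"
    using tele[of x] x_0 by (simp add: norm_tilde_def ip_tilde_def mesh_step_def)
  ultimately show ?thesis
    using ip_tilde_Cauchy_Schwarz[of "dx_back x W" "\<lambda>_. 1"] by (simp add: mult.commute)
qed

lemma space_time_Cauchy_Schwarz:
  "(\<Sum>m = 1..M. norm_tilde x J (V m) * norm_tilde x J (W m) * \<tau> m)
    \<le> norm_space_time x J t M V * norm_space_time x J t M W"
  using sum_Cauchy_Schwarz_weighted[of "{1..M}" \<tau> "\<lambda>m. norm_tilde x J (V m)" "\<lambda>m. norm_tilde x J (W m)"]
    \<tau>_pos by (simp add: norm_space_time_def less_imp_le)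

lemma norm_space_time_mono: "k \<le> M \<Longrightarrow> norm_space_time x J t k V \<le> norm_space_time x J t M V"
  unfolding norm_space_time_def using \<tau>_pos
  by (intro real_sqrt_le_mono sum_mono2) (auto simp: less_imp_le)

lemma norm_time_mono: "k \<le> M \<Longrightarrow> norm_time t k V \<le> norm_time t M V"
  unfolding norm_time_def using \<tau>_pos
  by (intro real_sqrt_le_mono sum_mono2) (auto simp: less_imp_le)

lemma norm_space_time_nonneg: "norm_space_time x J t M V \<ge> 0"
  and norm_time_nonneg: "norm_time t M \<Phi> \<ge> 0"
  unfolding norm_space_time_def norm_time_def using \<tau>_pos
  by (auto intro!: sum_nonneg simp: less_imp_le)

lemma derivative_norm_le_energy:
  assumes U: "\<And>m. U m 0 = 0"
  shows "norm_space_time x J t M (\<lambda>m. dx_back x (avg \<sigma> U m)) \<le> sqrt (energy M U / \<nu>)"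
proof -
  let ?d = "\<lambda>m. dx_back x (avg \<sigma> U m)"
  have "\<nu> * (norm_tilde x J V)\<^sup>2 \<le> (\<Sum>j = 1..J. b j * (V j)\<^sup>2 * h j)" for V
  proof -
    have "(norm_tilde x J V)\<^sup>2 = ip_tilde x J V V"
      using norm_tilde_nonneg[of V] by (simp add: norm_tilde_def)
    then have "\<nu> * (norm_tilde x J V)\<^sup>2 = (\<Sum>j = 1..J. \<nu> * (V j)\<^sup>2 * h j)"
      by (simp add: ip_tilde_def sum_distrib_left power2_eq_square mult_ac)
    also have "\<dots> \<le> (\<Sum>j = 1..J. b j * (V j)\<^sup>2 * h j)"
      using b_ge h_pos by (intro sum_mono mult_right_mono) (auto simp: less_imp_le)
    finally show ?thesis .
  qed
  then have "\<nu> * (\<Sum>m = 1..M. (norm_tilde x J (?d m))\<^sup>2 * \<tau> m)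
      \<le> (\<Sum>m = 1..M. (\<Sum>j = 1..J. b j * (?d m j)\<^sup>2 * h j) * \<tau> m)"
    unfolding sum_distrib_left mult.assoc[symmetric] using \<tau>_pos
    by (intro sum_mono mult_right_mono) (auto simp: less_imp_le)
  also have "\<dots> \<le> energy M U" using flux_norm_sq_le_energy[of U M, OF U] by (simp add: flux_norm_sq)
  finally show ?thesis
    unfolding norm_space_time_def using \<nu>_pos
    by (intro real_sqrt_le_mono) (simp add: pos_le_divide_eq mult.commute)
qed

text \<open>Summation by parts moves \<open>F1\<close> onto the difference quotient of the average, with no boundary term because \<open>F1\<close>
vanishes at the last node; the end value that meets \<open>G\<close> is controlled by the same difference quotient. So both
data cost a single factor, the square root of the energy.\<close>

lemma data_pairing_bound:
  assumes U: "\<And>m. U m 0 = 0" and F1: "\<And>m. m \<ge> 1 \<Longrightarrow> F1 m J = 0"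
  shows "(\<Sum>m = 1..M. ip_\<omega> x J (dx_hat x (F1 m)) (avg \<sigma> U m) * \<tau> m)
      + (\<Sum>m = 1..M. G m * avg \<sigma> U m J * \<tau> m)
    \<le> (norm_space_time x J t M F1 + sqrt (x J) * norm_time t M G) * sqrt (energy M U / \<nu>)"
proof -
  let ?d = "\<lambda>m. dx_back x (avg \<sigma> U m)"
  let ?n = "norm_space_time x J t M ?d"
  have \<tau>: "\<tau> m \<ge> 0" if "m \<in> {1..M}" for m using that \<tau>_pos by (auto simp: less_imp_le)
  have "(\<Sum>m = 1..M. ip_\<omega> x J (dx_hat x (F1 m)) (avg \<sigma> U m) * \<tau> m)
      \<le> (\<Sum>m = 1..M. norm_tilde x J (F1 m) * norm_tilde x J (?d m) * \<tau> m)"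
  proof (intro sum_mono mult_right_mono \<tau>)
    fix m assume "m \<in> {1..M}"
    then have "ip_\<omega> x J (dx_hat x (F1 m)) (avg \<sigma> U m) = - ip_tilde x J (F1 m) (?d m)"
      using summation_by_parts[where W = "avg \<sigma> U m", OF x_mono _ J_pos] avg_0[of U, OF U] F1 by simp
    then show "ip_\<omega> x J (dx_hat x (F1 m)) (avg \<sigma> U m) \<le> norm_tilde x J (F1 m) * norm_tilde x J (?d m)"
      using ip_tilde_Cauchy_Schwarz[of "F1 m" "?d m"] by linarith
  qed
  also have "\<dots> \<le> norm_space_time x J t M F1 * ?n" by (rule space_time_Cauchy_Schwarz)
  finally have 1: "(\<Sum>m = 1..M. ip_\<omega> x J (dx_hat x (F1 m)) (avg \<sigma> U m) * \<tau> m)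
      \<le> norm_space_time x J t M F1 * ?n" .
  have "(\<Sum>m = 1..M. G m * avg \<sigma> U m J * \<tau> m)
      \<le> (\<Sum>m = 1..M. sqrt (x J) * (\<bar>G m\<bar> * norm_tilde x J (?d m) * \<tau> m))"
  proof (intro sum_mono)
    fix m assume m: "m \<in> {1..M}"
    have "G m * avg \<sigma> U m J \<le> \<bar>G m\<bar> * \<bar>avg \<sigma> U m J\<bar>" by (metis abs_ge_self abs_mult)
    also have "\<dots> \<le> \<bar>G m\<bar> * (sqrt (x J) * norm_tilde x J (?d m))"
      using end_value_le_derivative_norm avg_0[of U, OF U] by (intro mult_left_mono) auto
    finally show "G m * avg \<sigma> U m J * \<tau> m \<le> sqrt (x J) * (\<bar>G m\<bar> * norm_tilde x J (?d m) * \<tau> m)"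
      using \<tau>[OF m] by (metis mult.assoc mult.left_commute mult_right_mono)
  qed
  also have "\<dots> = sqrt (x J) * (\<Sum>m = 1..M. \<bar>G m\<bar> * norm_tilde x J (?d m) * \<tau> m)"
    by (simp add: sum_distrib_left)
  also have "\<dots> \<le> sqrt (x J) * (norm_time t M G * ?n)"
  proof (intro mult_left_mono)
    show "(\<Sum>m = 1..M. \<bar>G m\<bar> * norm_tilde x J (?d m) * \<tau> m) \<le> norm_time t M G * ?n"
      using sum_Cauchy_Schwarz_weighted[of "{1..M}" \<tau> "\<lambda>m. \<bar>G m\<bar>" "\<lambda>m. norm_tilde x J (?d m)"] \<tau>
      by (simp add: norm_time_def norm_space_time_def)
    show "sqrt (x J) \<ge> 0" using x_mono x_0 by (metis real_sqrt_ge_zero strict_mono_less_eq zero_le)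
  qed
  finally have "(\<Sum>m = 1..M. ip_\<omega> x J (dx_hat x (F1 m)) (avg \<sigma> U m) * \<tau> m)
      + (\<Sum>m = 1..M. G m * avg \<sigma> U m J * \<tau> m)
      \<le> (norm_space_time x J t M F1 + sqrt (x J) * norm_time t M G) * ?n"
    using 1 by (simp add: algebra_simps)
  also have "\<dots> \<le> (norm_space_time x J t M F1 + sqrt (x J) * norm_time t M G) * sqrt (energy M U / \<nu>)"
    using x_mono x_0 norm_space_time_nonneg norm_time_nonneg derivative_norm_le_energy[of U, OF U]
    by (intro mult_left_mono add_nonneg_nonneg mult_nonneg_nonneg)
       (auto, metis strict_mono_less_eq zero_le)
  finally show ?thesis .
qed

lemma energy_inequality:
  assumes U: "\<And>m. U m 0 = 0" and U_end: "U 0 J = 0" and k: "k \<ge> 1"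
  shows "ip_C x J \<theta> \<rho> (U k) (U k) / 2 + energy k U \<le> ip_C x J \<theta> \<rho> (U 0) (U 0) / 2
    + (\<Sum>m = 1..k. ip_\<omega> x J (residual U m) (avg \<sigma> U m) * \<tau> m)
    + (\<Sum>m = 1..k. residual U m J * avg \<sigma> U m J * \<tau> m)"
proof -
  have "b J * (\<Sum>m = 1..k. S m (\<lambda>i. U i J) * time_avg \<sigma> (\<lambda>i. U i J) m * \<tau> m) \<le> 0"
    using S_dissipative[OF k, of "\<lambda>i. U i J"] U_end b_pos[of J] J_pos
    by (simp add: mult_nonneg_nonpos)
  then show ?thesis using energy_identity[of U k, OF U] by linarith
qed

text \<open>The load \<open>f\<close> enters only through the assumed bound \<open>P\<close>, which covers both
\<open>\<theta> < 1/4\<close> and, with \<open>f = 0\<close> and \<open>P = 0\<close>, the limit case.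
The inequality is used at every level \<open>k \<le> M\<close> with the same right-hand side \<open>R\<close>: at the level where the
maximum is attained it bounds the first norm, at the last level the energy norm.\<close>

lemma stability_bound:
  assumes U: "\<And>m. U m 0 = 0" and U_end: "U 0 J = 0"
    and interior: "\<And>m j. m \<ge> 1 \<Longrightarrow> j \<in> {1..<J} \<Longrightarrow> residual U m j = f m j + dx_hat x (g m) j"
    and boundary: "\<And>m. m \<ge> 1 \<Longrightarrow> residual U m J = G m"
    and g: "\<And>m. m \<ge> 1 \<Longrightarrow> g m J = 0"
    and P: "P \<ge> 0"
    and f: "\<And>k. k \<le> M \<Longrightarrow> (\<Sum>m = 1..k. ip_\<omega> x J (f m) (avg \<sigma> U m) * \<tau> m)
      \<le> P / 2 * Max ((\<lambda>m. norm_C x J \<theta> \<rho> (U m)) ` {0..M})"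
  shows "max (Max ((\<lambda>m. norm_C x J \<theta> \<rho> (U m)) ` {0..M})) (sqrt 2 * energy_norm x J t \<sigma> \<theta> \<rho> b c M U)
    \<le> norm_C x J \<theta> \<rho> (U 0) + P
      + sqrt (2 / \<nu>) * (norm_space_time x J t M g + sqrt (x J) * norm_time t M G)"
proof -
  define Y where "Y = Max ((\<lambda>m. norm_C x J \<theta> \<rho> (U m)) ` {0..M})"
  define E where "E = energy_norm x J t \<sigma> \<theta> \<rho> b c M U"
  define a where "a = norm_C x J \<theta> \<rho> (U 0)"
  define A where "A k = norm_space_time x J t k g + sqrt (x J) * norm_time t k G" for k
  \<comment> \<open>The factor \<open>sqrt 2\<close> is absorbed by measuring the energy norm as \<open>sqrt 2 * E\<close>.\<close>
  define Q where "Q = sqrt (2 / \<nu>) * A M"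
  define N where "N = max Y (sqrt 2 * E)"
  define R where "R = a\<^sup>2 + P * Y + Q * (sqrt 2 * E)"
  have energy_nonneg: "energy k U \<ge> 0" for k
    using energy_nonneg U by blast
  then have E: "E\<^sup>2 = energy M U" "E \<ge> 0"
    using energy_norm_eq[of U M, OF U] by (simp_all add: E_def)
  have xJ: "x J \<ge> 0" using x_mono x_0 by (metis strict_mono_less_eq zero_le)
  have norm_nonneg: "norm_C x J \<theta> \<rho> (U k) \<ge> 0" for k
    using ip_\<rho>_nonneg[of "U k"] U by (simp add: norm_C_def)
  have norm_le_Y: "norm_C x J \<theta> \<rho> (U k) \<le> Y" if "k \<le> M" for k
    unfolding Y_def using that by (intro Max_ge) auto
  have A_mono: "A k \<le> A M" if "k \<le> M" for k
    unfolding A_def using that xJ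
    by (intro add_mono mult_left_mono norm_space_time_mono norm_time_mono) auto
  have A_nonneg: "A k \<ge> 0" for k
    unfolding A_def using xJ norm_space_time_nonneg norm_time_nonneg by simp
  have Q_E: "Q * (sqrt 2 * E) = 2 * (A M * (E / sqrt \<nu>))"
    by (simp add: Q_def real_sqrt_divide)
  have level: "(norm_C x J \<theta> \<rho> (U k))\<^sup>2 + 2 * energy k U \<le> R" if k: "k \<le> M" for k
  proof (cases "k = 0")
    case True
    have "a\<^sup>2 \<le> R"
      using P norm_nonneg[of 0] norm_le_Y[of 0] A_nonneg E \<nu>_pos by (simp add: R_def Q_def)
    then show ?thesis using True by (simp add: a_def energy_def)
  next
    case False
    then have k1: "k \<ge> 1" by simp
    have "ip_\<omega> x J (residual U m) W = ip_\<omega> x J (f m) W + ip_\<omega> x J (dx_hat x (g m)) W"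
      if "m \<ge> 1" for m W
      unfolding ip_\<omega>_def sum.distrib[symmetric]
      using interior[OF that] by (intro sum.cong) (auto simp: distrib_right)
    then have split: "(\<Sum>m = 1..k. ip_\<omega> x J (residual U m) (avg \<sigma> U m) * \<tau> m)
        = (\<Sum>m = 1..k. ip_\<omega> x J (f m) (avg \<sigma> U m) * \<tau> m)
        + (\<Sum>m = 1..k. ip_\<omega> x J (dx_hat x (g m)) (avg \<sigma> U m) * \<tau> m)"
      unfolding sum.distrib[symmetric] by (intro sum.cong) (auto simp: distrib_right)
    have bdry: "(\<Sum>m = 1..k. residual U m J * avg \<sigma> U m J * \<tau> m)
        = (\<Sum>m = 1..k. G m * avg \<sigma> U m J * \<tau> m)"
      using boundary by (intro sum.cong) auto
    have "A k * sqrt (energy k U / \<nu>) \<le> A M * sqrt (energy M U / \<nu>)"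
      using A_mono[OF k] A_nonneg energy_mono[of U, OF U k] energy_nonneg \<nu>_pos
      by (intro mult_mono) (auto simp: divide_right_mono)
    also have "sqrt (energy M U / \<nu>) = E / sqrt \<nu>"
      using E by (simp add: real_sqrt_divide flip: E(1))
    finally have "ip_C x J \<theta> \<rho> (U k) (U k) / 2 + energy k U
        \<le> ip_C x J \<theta> \<rho> (U 0) (U 0) / 2 + P / 2 * Y + A M * (E / sqrt \<nu>)"
      using energy_inequality[of U, OF U U_end k1] f[OF k]
        data_pairing_bound[of U g k G, OF U g]
      unfolding split bdry Y_def A_def by linarith
    then show ?thesis
      unfolding R_def Q_E a_def using U by (simp add: norm_\<rho>_sq)
  qed
  have "Y \<in> (\<lambda>m. norm_C x J \<theta> \<rho> (U m)) ` {0..M}" unfolding Y_def by (intro Max_in) auto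
  then obtain k where "k \<le> M" "Y = norm_C x J \<theta> \<rho> (U k)" by auto
  then have Y_sq: "Y\<^sup>2 \<le> R" using level[of k] energy_nonneg[of k] by simp
  have E_sq: "(sqrt 2 * E)\<^sup>2 \<le> R"
    using level[of M] by (simp add: power_mult_distrib E(1)) (smt (verit) zero_le_power2)
  have "N \<le> a + P + Q"
  proof (rule le_of_energy_inequalities[OF _ Y_sq E_sq])
    show "N = Y \<or> N = sqrt 2 * E" by (auto simp: N_def max_def)
    show "0 \<le> a" by (simp add: a_def norm_nonneg)
    show "a \<le> N" using norm_le_Y[of 0] by (simp add: N_def a_def)
    then show "0 \<le> N" using \<open>0 \<le> a\<close> by linarith
    show "0 \<le> P" by (fact P)
    show Q: "0 \<le> Q" using A_nonneg \<nu>_pos by (simp add: Q_def)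
    show "R \<le> a\<^sup>2 + P * N + Q * N"
      unfolding R_def using P Q by (intro add_mono mult_left_mono) (auto simp: N_def)
  qed
  then show ?thesis by (simp add: N_def Y_def E_def a_def Q_def A_def)
qed

text \<open>The average is a combination of two levels whose coefficients have absolute values \<open>\<sigma>\<close> and
\<open>\<bar>1 - \<sigma>\<bar>\<close>; their sum is half of \<open>K_const \<sigma>\<close>.\<close>

lemma load_pairing_bound:
  assumes \<theta>: "\<theta> < 1 / 4" and U: "\<And>m. U m 0 = 0" and k: "k \<le> M"
  shows "(\<Sum>m = 1..k. ip_\<omega> x J (F0 m) (avg \<sigma> U m) * \<tau> m)
    \<le> K_const \<sigma> / sqrt (c_const \<theta> * \<rho>\<^sub>l) * (\<Sum>m = 1..M. norm_\<omega> x J (F0 m) * \<tau> m) / 2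
      * Max ((\<lambda>m. norm_C x J \<theta> \<rho> (U m)) ` {0..M})"
proof -
  define Y where "Y = Max ((\<lambda>m. norm_C x J \<theta> \<rho> (U m)) ` {0..M})"
  define s where "s = sqrt (c_const \<theta> * \<rho>\<^sub>l)"
  have s: "s > 0" using c_const_pos[OF \<theta>] \<rho>\<^sub>l_pos by (simp add: s_def)
  have norm_\<omega>_nonneg: "norm_\<omega> x J W \<ge> 0" for W
    by (simp add: norm_\<omega>_def ip_\<omega>_nonneg)
  have norm_\<omega>_le: "norm_\<omega> x J (U m) \<le> Y / s" if "m \<le> M" for m
  proof -
    have "c_const \<theta> * \<rho>\<^sub>l * ip_\<omega> x J (U m) (U m) \<le> ip_C x J \<theta> \<rho> (U m) (U m)"
      using ip_C_lower_bound[where W = "U m" and k = \<rho>\<^sub>l, OF x_mono J_pos U \<theta>_le _ \<rho>_ge] \<rho>\<^sub>l_pos by simp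
    then have "s * norm_\<omega> x J (U m) \<le> norm_C x J \<theta> \<rho> (U m)"
      unfolding s_def norm_\<omega>_def norm_C_def real_sqrt_mult[symmetric] by (rule real_sqrt_le_mono)
    also have "\<dots> \<le> Y" unfolding Y_def using that by (intro Max_ge) auto
    finally show ?thesis using s by (simp add: pos_le_divide_eq mult.commute)
  qed
  have pair: "ip_\<omega> x J V (U m) \<le> norm_\<omega> x J V * (Y / s)"
    "- ip_\<omega> x J V (U m) \<le> norm_\<omega> x J V * (Y / s)" if "m \<le> M" for V m
    using ip_\<omega>_Cauchy_Schwarz[of V "U m"] mult_left_mono[OF norm_\<omega>_le[OF that] norm_\<omega>_nonneg[of V]]
    by linarith+
  have avg_pair: "ip_\<omega> x J V (avg \<sigma> U m) \<le> (\<sigma> + \<bar>1 - \<sigma>\<bar>) * (norm_\<omega> x J V * (Y / s))" if "m \<le> M" for V m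
  proof -
    have "ip_\<omega> x J V (avg \<sigma> U m) = \<sigma> * ip_\<omega> x J V (U m) + (1 - \<sigma>) * ip_\<omega> x J V (U (m - 1))"
      by (simp add: ip_\<omega>_def avg_def time_avg_def sum_distrib_left sum.distrib[symmetric] algebra_simps)
    also have "(1 - \<sigma>) * ip_\<omega> x J V (U (m - 1)) \<le> \<bar>1 - \<sigma>\<bar> * (norm_\<omega> x J V * (Y / s))"
    proof -
      have "\<bar>ip_\<omega> x J V (U (m - 1))\<bar> \<le> norm_\<omega> x J V * (Y / s)" using pair[of "m - 1" V] that by linarith
      then show ?thesis
        using abs_ge_self[of "(1 - \<sigma>) * ip_\<omega> x J V (U (m - 1))"]
          mult_left_mono[of "\<bar>ip_\<omega> x J V (U (m - 1))\<bar>" _ "\<bar>1 - \<sigma>\<bar>"]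
        unfolding abs_mult by fastforce
    qed
    also have "\<sigma> * ip_\<omega> x J V (U m) \<le> \<sigma> * (norm_\<omega> x J V * (Y / s))"
      using pair(1)[OF that] \<sigma>_ge by (intro mult_left_mono) auto
    finally show ?thesis by (simp only: distrib_right)
  qed
  have Y: "Y \<ge> 0" using norm_\<omega>_le[of 0] norm_\<omega>_nonneg[of "U 0"] s
    by (meson le0 order_trans zero_le_divide_iff not_less)
  have "(\<Sum>m = 1..k. ip_\<omega> x J (F0 m) (avg \<sigma> U m) * \<tau> m)
      \<le> (\<Sum>m = 1..k. (\<sigma> + \<bar>1 - \<sigma>\<bar>) * (norm_\<omega> x J (F0 m) * (Y / s)) * \<tau> m)"
    using k \<tau>_pos by (intro sum_mono mult_right_mono avg_pair) (auto simp: less_imp_le)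
  also have "\<dots> \<le> (\<Sum>m = 1..M. (\<sigma> + \<bar>1 - \<sigma>\<bar>) * (norm_\<omega> x J (F0 m) * (Y / s)) * \<tau> m)"
    using k \<tau>_pos \<sigma>_ge Y s norm_\<omega>_nonneg
    by (intro sum_mono2 mult_nonneg_nonneg) (auto simp: less_imp_le)
  also have "\<dots> = K_const \<sigma> / s * (\<Sum>m = 1..M. norm_\<omega> x J (F0 m) * \<tau> m) / 2 * Y"
  proof -
    have "K_const \<sigma> / s * Z / 2 * Y = (\<sigma> + \<bar>1 - \<sigma>\<bar>) * (Y / s) * Z" for Z
      using s by (simp add: K_const_def field_simps)
    then show ?thesis by (simp only:) (simp add: sum_distrib_left mult_ac)
  qed
  finally show ?thesis by (simp add: Y_def s_def)
qed

section \<open>Unique solvability\<close>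

text \<open>A mesh function that lives on the level \<open>m\<close> alone has zero initial norm, so a vanishing residual forces its energy up to that
level to vanish. The term with \<open>b\<close> then makes the average, which is \<open>\<sigma>\<close> times the
level itself, constant in space.\<close>

lemma step_injective:
  assumes m: "m \<ge> 1" and u: "u 0 = 0"
    and zero: "\<And>j. j \<in> {1..J} \<Longrightarrow> residual (\<lambda>k j. if k = m then u j else 0) m j = 0"
    and j: "j \<le> J"
  shows "u j = 0"
proof -
  define U :: "nat \<Rightarrow> nat \<Rightarrow> real" where "U = (\<lambda>k j. if k = m then u j else 0)"
  have U0: "U k 0 = 0" for k using u by (simp add: U_def)
  have residual_U: "residual U k i = 0" if k: "k \<in> {1..m}" and i: "i \<in> {1..J}" for k i
  proof (cases "k = m")
    case True
    then show ?thesis using zero[OF i] by (simp add: U_def)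
  next
    case False
    have "residual U k i = residual (\<lambda>k j. 0 * U k j + 0 * U k j) k i"
      using k i False by (intro residual_cong) (auto simp: U_def)
    then show ?thesis using residual_linear[of k 0 U 0 U i] k by simp
  qed
  have "ip_\<omega> x J (residual U k) W = 0" if "k \<in> {1..m}" for k W
    unfolding ip_\<omega>_def using residual_U[OF that] by (intro sum.neutral) auto
  then have "ip_C x J \<theta> \<rho> (U m) (U m) / 2 + energy m U \<le> ip_C x J \<theta> \<rho> (U 0) (U 0) / 2"
    using energy_inequality[of U, OF U0 _ m] residual_U J_pos m by (simp add: U_def)
  moreover have "ip_C x J \<theta> \<rho> (U 0) (U 0) = 0"
    using m by (simp add: U_def ip_C_def ip_\<omega>_def)
  ultimately have "energy m U \<le> 0" using ip_\<rho>_nonneg[of "U m", OF U0] by linarith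
  then have "(\<Sum>k = 1..m. (\<Sum>j = 1..J. b j * (dx_back x (avg \<sigma> U k) j)\<^sup>2 * h j) * \<tau> k) \<le> 0"
    using flux_norm_sq_le_energy[of U m, OF U0] unfolding flux_norm_sq by linarith
  moreover have "(\<Sum>j = 1..J. b j * (dx_back x (avg \<sigma> U m) j)\<^sup>2 * h j) * \<tau> m
      \<le> (\<Sum>k = 1..m. (\<Sum>j = 1..J. b j * (dx_back x (avg \<sigma> U k) j)\<^sup>2 * h j) * \<tau> k)"
    using m \<tau>_pos by (intro member_le_sum mult_nonneg_nonneg flux_nonneg) (auto simp: less_imp_le)
  ultimately have "(\<Sum>j = 1..J. b j * (dx_back x (avg \<sigma> U m) j)\<^sup>2 * h j) \<le> 0"
    using \<tau>_pos[OF m] by (smt (verit) mult_pos_pos)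
  then have "(\<Sum>j = 1..J. b j * (dx_back x (avg \<sigma> U m) j)\<^sup>2 * h j) = 0"
    using flux_nonneg by (intro antisym) auto
  then have flux: "b i * (dx_back x (avg \<sigma> U m) i)\<^sup>2 * h i = 0" if "i \<in> {1..J}" for i
    using that b_pos h_pos by (subst (asm) sum_nonneg_eq_0_iff) (auto simp: less_imp_le)
  have const: "u i = u (i - 1)" if i: "i \<in> {1..J}" for i
  proof -
    have "dx_back x (avg \<sigma> U m) i = 0" using flux[OF i] b_pos[OF i] h_pos[of i] i by simp
    then have "\<sigma> * u i = \<sigma> * u (i - 1)"
      using h_pos[of i] i m by (auto simp add: dx_back_def avg_def time_avg_def U_def split: if_splits)
    then show ?thesis using \<sigma>_ge by simp
  qed
  show ?thesis using j
  proof (induction j)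
    case 0
    show ?case by (fact u)
  next
    case (Suc j)
    then show ?case using const[of "Suc j"] by simp
  qed
qed

text \<open>By linearity the residual splits into the part of the unknown level and that of the past \<open>H\<close>, which
goes to the right-hand side.\<close>

lemma step_solvable:
  assumes m: "m \<ge> 1"
  shows "\<exists>u. u 0 = 0 \<and> (\<forall>j\<in>{1..J}. residual (\<lambda>k i. if k = m then u i else H k i) m j = f j)"
proof -
  let ?one = "\<lambda>u k (i::nat). if k = m then u i else (0::real)"
  let ?past = "\<lambda>k i. if k = m then 0 else H k i"
  let ?L = "\<lambda>u. residual (?one u) m"
  have lin: "?L (\<lambda>k. r * u k + s * v k) i = r * ?L u i + s * ?L v i" for r s u v i
  proof -
    have "?one (\<lambda>k. r * u k + s * v k) = (\<lambda>k i. r * ?one u k i + s * ?one v k i)"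
      by (intro ext) simp
    then show ?thesis using residual_linear[OF m, of r "?one u" s "?one v" i] by simp
  qed
  have "\<exists>u. (\<forall>k. k \<notin> {1..J} \<longrightarrow> u k = 0) \<and> (\<forall>i\<in>{1..J}. ?L u i = f i - residual ?past m i)"
  proof (rule injective_linear_system_solvable)
    show "?L (\<lambda>k. u k + v k) i = ?L u i + ?L v i" for u v i
      using lin[of 1 u 1 v i] by (simp only: mult_1)
    show "?L (\<lambda>k. r * u k) i = r * ?L u i" for r u i
      using lin[of r u 0 u i] by (simp only: mult_zero_left add_0_right)
    show "u k = 0" if "\<And>k. k \<notin> {1..J} \<Longrightarrow> u k = 0" "\<And>i. i \<in> {1..J} \<Longrightarrow> ?L u i = 0" for u k
      using that step_injective[OF m, of u k] by (cases "k \<in> {1..J}") auto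
  qed auto
  then obtain u where u: "\<And>k. k \<notin> {1..J} \<Longrightarrow> u k = 0"
    and Lu: "\<And>i. i \<in> {1..J} \<Longrightarrow> ?L u i = f i - residual ?past m i" by blast
  have "(\<lambda>k i. if k = m then u i else H k i) = (\<lambda>k i. 1 * ?one u k i + 1 * ?past k i)"
    by (intro ext) simp
  then have "residual (\<lambda>k i. if k = m then u i else H k i) m i = ?L u i + residual ?past m i" for i
    using residual_linear[OF m, of 1 "?one u" 1 ?past i] by simp
  then show ?thesis using u[of 0] Lu by (intro exI[of _ u]) simp
qed

lemma scheme_unique:
  assumes U: "\<And>m j. m \<ge> 1 \<Longrightarrow> j \<in> {1..J} \<Longrightarrow> residual U m j = f m j" "\<And>m. m \<ge> 1 \<Longrightarrow> U m 0 = 0"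
    and V: "\<And>m j. m \<ge> 1 \<Longrightarrow> j \<in> {1..J} \<Longrightarrow> residual V m j = f m j" "\<And>m. m \<ge> 1 \<Longrightarrow> V m 0 = 0"
    and init: "\<And>j. j \<le> J \<Longrightarrow> V 0 j = U 0 j"
    and j: "j \<le> J"
  shows "V m j = U m j"
  using j
proof (induction m arbitrary: j rule: less_induct)
  case (less m)
  show ?case
  proof (cases "m = 0")
    case True
    then show ?thesis using init less.prems by simp
  next
    case False
    then have m: "m \<ge> 1" by simp
    let ?D = "\<lambda>k j. 1 * V k j + (- 1) * U k j"
    have "V m j - U m j = 0"
    proof (rule step_injective[where u = "\<lambda>i. V m i - U m i", OF m _ _ less.prems])
      show "V m 0 - U m 0 = 0" using U V m by simp
      show "residual (\<lambda>k j. if k = m then V m j - U m j else 0) m i = 0" if i: "i \<in> {1..J}" for i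
      proof -
        have "residual (\<lambda>k j. if k = m then V m j - U m j else 0) m i = residual ?D m i"
          using m i less.IH by (intro residual_cong) auto
        then show ?thesis
          using residual_linear[OF m, of 1 V "- 1" U i] U V m i by simp
      qed
    qed
    then show ?thesis by simp
  qed
qed

text \<open>A solution is built level by level; the recursion carries the entire history because \<open>S\<close> depends on all of it.\<close>

lemma scheme_exists:
  assumes "U\<^sub>0 0 = 0"
  shows "\<exists>U. (\<forall>m\<ge>1. \<forall>j\<in>{1..J}. residual U m j = f m j) \<and> (\<forall>m\<ge>1. U m 0 = 0) \<and> (\<forall>j\<le>J. U 0 j = U\<^sub>0 j)"
proof -
  define ok where "ok n H \<longleftrightarrow> H 0 = U\<^sub>0 \<and>
      (\<forall>m\<in>{1..n}. H m 0 = 0 \<and> (\<forall>j\<in>{1..J}. residual H m j = f m j))" for n and H :: "nat \<Rightarrow> nat \<Rightarrow> real"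
  have "\<exists>H. \<forall>n. ok n (H n) \<and> (\<forall>k\<le>n. H (Suc n) k = H n k)"
  proof (rule dependent_nat_choice[where P = ok and Q = "\<lambda>n H H'. \<forall>k\<le>n. H' k = H k"])
    show "\<exists>H. ok 0 H" by (auto simp: ok_def intro: exI[of _ "\<lambda>_. U\<^sub>0"])
  next
    fix H n assume H: "ok n H"
    obtain u where u: "u 0 = 0"
      "\<forall>j\<in>{1..J}. residual (\<lambda>k i. if k = Suc n then u i else H k i) (Suc n) j = f (Suc n) j"
      using step_solvable[of "Suc n" H "f (Suc n)"] by auto
    define H' where "H' = (\<lambda>k i. if k = Suc n then u i else H k i)"
    have "residual H' m j = f m j" if m: "m \<in> {1..Suc n}" and j: "j \<in> {1..J}" for m j
    proof (cases "m = Suc n")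
      case True
      then show ?thesis using u j by (simp add: H'_def)
    next
      case False
      have "residual H' m j = residual H m j"
        using m j False by (intro residual_cong) (auto simp: H'_def)
      then show ?thesis using H m j False by (simp add: ok_def)
    qed
    then have "ok (Suc n) H'" using H u by (auto simp: ok_def H'_def)
    moreover have "\<forall>k\<le>n. H' k = H k" by (auto simp: H'_def)
    ultimately show "\<exists>H'. ok (Suc n) H' \<and> (\<forall>k\<le>n. H' k = H k)" by blast
  qed
  then obtain H where ok: "\<And>n. ok n (H n)" and ext: "\<And>n k. k \<le> n \<Longrightarrow> H (Suc n) k = H n k" by blast
  have agree: "H n k = H k k" if "k \<le> n" for n k
    using that by (induction n rule: dec_induct) (auto simp: ext)
  define U where "U m = H m m" for m
  have "residual U m j = f m j" if "m \<ge> 1" "j \<in> {1..J}" for m j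
  proof -
    have "U k i = H m k i" if "k \<le> m" for k i
      using agree[OF that] by (simp add: U_def)
    then have "residual U m j = residual (H m) m j"
      using that by (intro residual_cong) auto
    then show ?thesis using ok[of m] that by (simp add: ok_def)
  qed
  moreover have "U m 0 = 0" if "m \<ge> 1" for m using ok[of m] that by (simp add: ok_def U_def)
  moreover have "U 0 = U\<^sub>0" using ok[of 0] by (simp add: ok_def U_def)
  ultimately show ?thesis by blast
qed

end

section \<open>Stability and unique solvability of the scheme\<close>

theorem proposition1:
  fixes \<rho> b c :: "real \<Rightarrow> real"
    and \<rho>\<^sub>l \<nu> \<rho>_inf b_inf c_inf X\<^sub>0 X \<sigma> \<theta> :: real
    and J :: nat
    and x t :: "nat \<Rightarrow> real"
    and \<rho>\<^sub>h b\<^sub>h c\<^sub>h :: "nat \<Rightarrow> real"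
    and S :: "nat \<Rightarrow> (nat \<Rightarrow> real) \<Rightarrow> real"
    and F :: "nat \<Rightarrow> nat \<Rightarrow> real"
    and G U\<^sub>0 :: "nat \<Rightarrow> real"
  assumes cont: "continuous_on {0<..} \<rho>" "continuous_on {0<..} b" "continuous_on {0<..} c"
    and rho_lower: "\<rho>\<^sub>l > 0" "\<And>y. y > 0 \<Longrightarrow> \<rho> y \<ge> \<rho>\<^sub>l"
    and b_lower: "\<nu> > 0" "\<And>y. y > 0 \<Longrightarrow> b y \<ge> \<nu>"
    and c_nonneg: "\<And>y. y > 0 \<Longrightarrow> c y \<ge> 0"
    and inf_const: "\<rho>_inf > 0" "b_inf > 0" "c_inf \<ge> 0"
    and X0: "X\<^sub>0 > 0" "X > X\<^sub>0"
    and const_far: "\<And>y. y \<ge> X\<^sub>0 \<Longrightarrow> \<rho> y = \<rho>_inf" "\<And>y. y \<ge> X\<^sub>0 \<Longrightarrow> b y = b_inf"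
      "\<And>y. y \<ge> X\<^sub>0 \<Longrightarrow> c y = c_inf"
    and meshes: "space_mesh X\<^sub>0 X J x" "time_mesh t"
    and coeffs: "\<rho>\<^sub>h = mesh_coeff x \<rho>" "b\<^sub>h = mesh_coeff x b" "c\<^sub>h = mesh_coeff x c"
    and init: "U\<^sub>0 0 = 0" "U\<^sub>0 J = 0"
    and S_linear: "\<And>m. m \<ge> 1 \<Longrightarrow> linear_on_history m (S m)"
    and S_dissipative: "\<And>M \<Phi>. M \<ge> 1 \<Longrightarrow> \<Phi> 0 = 0 \<Longrightarrow>
      (\<Sum>m = 1..M. S m \<Phi> * time_avg \<sigma> \<Phi> m * mesh_step t m) \<le> 0"
    and sigma: "\<sigma> \<ge> 1 / 2"
  shows
    "(\<theta> < 1 / 4 \<longrightarrow>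
       (\<forall>U. scheme_solution x J t \<sigma> \<theta> \<rho>\<^sub>h b\<^sub>h c\<^sub>h \<rho>_inf b_inf c_inf S F G U\<^sub>0 U \<longrightarrow>
         (\<forall>M\<ge>1. \<forall>F0 F1.
            (\<forall>m\<ge>1. \<forall>j\<in>{1..<J}. F m j = F0 m j + dx_hat x (F1 m) j) \<longrightarrow>
            (\<forall>m\<ge>1. F1 m J = 0) \<longrightarrow>
            max (Max ((\<lambda>m. norm_C x J \<theta> \<rho>\<^sub>h (U m)) ` {0..M}))
                (sqrt 2 * energy_norm x J t \<sigma> \<theta> \<rho>\<^sub>h b\<^sub>h c\<^sub>h M U)
            \<le> norm_C x J \<theta> \<rho>\<^sub>h U\<^sub>0
              + K_const \<sigma> / sqrt (c_const \<theta> * \<rho>\<^sub>l)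
                * (\<Sum>m = 1..M. norm_\<omega> x J (F0 m) * mesh_step t m)
              + sqrt (2 / \<nu>) * (norm_space_time x J t M F1 + sqrt X * norm_time t M G)))) \<and>
     (\<theta> = 1 / 4 \<longrightarrow>
       (\<forall>U. scheme_solution x J t \<sigma> \<theta> \<rho>\<^sub>h b\<^sub>h c\<^sub>h \<rho>_inf b_inf c_inf S F G U\<^sub>0 U \<longrightarrow>
         (\<forall>M\<ge>1. \<forall>F1.
            (\<forall>m\<ge>1. \<forall>j\<in>{1..<J}. F m j = dx_hat x (F1 m) j) \<longrightarrow>
            (\<forall>m\<ge>1. F1 m J = 0) \<longrightarrow>
            max (Max ((\<lambda>m. norm_C x J \<theta> \<rho>\<^sub>h (U m)) ` {0..M}))
                (sqrt 2 * energy_norm x J t \<sigma> \<theta> \<rho>\<^sub>h b\<^sub>h c\<^sub>h M U)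
            \<le> norm_C x J \<theta> \<rho>\<^sub>h U\<^sub>0
              + sqrt (2 / \<nu>) * (norm_space_time x J t M F1 + sqrt X * norm_time t M G)))) \<and>
     (\<theta> \<le> 1 / 4 \<longrightarrow>
       (\<exists>U. scheme_solution x J t \<sigma> \<theta> \<rho>\<^sub>h b\<^sub>h c\<^sub>h \<rho>_inf b_inf c_inf S F G U\<^sub>0 U \<and>
         (\<forall>V. scheme_solution x J t \<sigma> \<theta> \<rho>\<^sub>h b\<^sub>h c\<^sub>h \<rho>_inf b_inf c_inf S F G U\<^sub>0 V \<longrightarrow>
           (\<forall>m. \<forall>j\<le>J. V m j = U m j))))"



proof -
  have x_mono: "strict_mono x" and x_0: "x 0 = 0" and x_J: "x J = X" and t_mono: "strict_mono t"
    and last_cell: "x J - x (J - 1) \<le> X - X\<^sub>0"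
    using meshes by (auto simp: space_mesh_def time_mesh_def mesh_step_def)
  have J_pos: "J \<ge> 1" using x_0 x_J X0 by (cases J) auto
  have midpoint_pos: "(x (j - 1) + x j) / 2 > 0" if "j \<in> {1..J}" for j
  proof -
    have "x 0 \<le> x (j - 1)" "x 0 < x j"
      using x_mono that by (auto simp: strict_mono_less strict_mono_less_eq)
    then show ?thesis using x_0 by simp
  qed
  \<comment> \<open>The last cell lies beyond \<open>X\<^sub>0\<close>, so the mesh coefficients there are the constants at infinity.\<close>
  have last_midpoint: "(x (J - 1) + x J) / 2 \<ge> X\<^sub>0" using last_cell x_J X0 by simp
  have at_J: "\<rho>_inf = \<rho>\<^sub>h J" "b_inf = b\<^sub>h J" "c_inf = c\<^sub>h J"
    unfolding coeffs mesh_coeff_def using const_far[OF last_midpoint] by simp_all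
  show ?thesis
  proof (cases "\<theta> \<le> 1 / 4")
    case False
    then show ?thesis by auto
  next
    case True
    interpret dissipative_scheme x t J \<rho>\<^sub>h b\<^sub>h c\<^sub>h S \<sigma> \<theta> \<rho>\<^sub>l \<nu>
    proof
      show "\<rho>\<^sub>h j \<ge> \<rho>\<^sub>l" "b\<^sub>h j \<ge> \<nu>" "c\<^sub>h j \<ge> 0" if "j \<in> {1..J}" for j
        using midpoint_pos[OF that] rho_lower b_lower c_nonneg by (auto simp: coeffs mesh_coeff_def)
      show "linear_on_history m (S m)" if "m \<ge> 1" for m using that by (rule S_linear)
      show "(\<Sum>m = 1..M. S m \<Phi> * time_avg \<sigma> \<Phi> m * mesh_step t m) \<le> 0"
        if "M \<ge> 1" "\<Phi> 0 = 0" for M \<Phi>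
        using that by (rule S_dissipative)
    qed (fact x_mono x_0 t_mono J_pos rho_lower(1) b_lower(1) sigma True)+
    let ?sol = "scheme_solution x J t \<sigma> \<theta> \<rho>\<^sub>h b\<^sub>h c\<^sub>h \<rho>_inf b_inf c_inf S F G U\<^sub>0"
    have sol_iff: "?sol U \<longleftrightarrow>
        (\<forall>m\<ge>1. \<forall>j\<in>{1..J}. residual U m j = (if j < J then F m j else G m)) \<and>
        (\<forall>m\<ge>1. U m 0 = 0) \<and> (\<forall>j\<le>J. U 0 j = U\<^sub>0 j)" for U
      unfolding at_J by (rule scheme_solution_iff_residual)
    have bound: "max (Max ((\<lambda>m. norm_C x J \<theta> \<rho>\<^sub>h (U m)) ` {0..M}))
          (sqrt 2 * energy_norm x J t \<sigma> \<theta> \<rho>\<^sub>h b\<^sub>h c\<^sub>h M U)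
        \<le> norm_C x J \<theta> \<rho>\<^sub>h U\<^sub>0 + P
          + sqrt (2 / \<nu>) * (norm_space_time x J t M g + sqrt X * norm_time t M G)"
      if sol: "?sol U" and F: "\<forall>m\<ge>1. \<forall>j\<in>{1..<J}. F m j = f m j + dx_hat x (g m) j"
        and g: "\<forall>m\<ge>1. g m J = 0" and P: "P \<ge> 0"
        and f: "\<And>k. (\<And>m. U m 0 = 0) \<Longrightarrow> k \<le> M \<Longrightarrow>
          (\<Sum>m = 1..k. ip_\<omega> x J (f m) (avg \<sigma> U m) * mesh_step t m)
          \<le> P / 2 * Max ((\<lambda>m. norm_C x J \<theta> \<rho>\<^sub>h (U m)) ` {0..M})" for U M f g P
    proof -
      have eqs: "residual U m j = (if j < J then F m j else G m)" if "m \<ge> 1" "j \<in> {1..J}" for m j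
        using sol that unfolding sol_iff by blast
      have start: "U 0 j = U\<^sub>0 j" if "j \<le> J" for j using sol that unfolding sol_iff by blast
      have U: "U m 0 = 0" for m
        using sol start[of 0] init(1) unfolding sol_iff by (cases "m = 0") auto
      have norm_start: "norm_C x J \<theta> \<rho>\<^sub>h U\<^sub>0 = norm_C x J \<theta> \<rho>\<^sub>h (U 0)"
        using start by (intro norm_C_cong) simp
      show ?thesis unfolding norm_start x_J[symmetric]
      proof (rule stability_bound[where U = U and f = f and g = g, OF U])
        show "U 0 J = 0" using start init(2) by simp
        show "residual U m j = f m j + dx_hat x (g m) j" if "m \<ge> 1" "j \<in> {1..<J}" for m j
          using eqs[of m j] F that by simp
        show "residual U m J = G m" if "m \<ge> 1" for m using eqs[of m J] that J_pos by simp
        show "g m J = 0" if "m \<ge> 1" for m using g that by blast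
        show "P \<ge> 0" by (fact P)
        show "(\<Sum>m = 1..k. ip_\<omega> x J (f m) (avg \<sigma> U m) * mesh_step t m)
          \<le> P / 2 * Max ((\<lambda>m. norm_C x J \<theta> \<rho>\<^sub>h (U m)) ` {0..M})" if "k \<le> M" for k
          using U that by (rule f)
      qed
    qed
    show ?thesis
    proof (intro conjI impI allI)
      fix U M F0 F1
      assume \<theta>: "\<theta> < 1 / 4" and sol: "?sol U"
        and F: "\<forall>m\<ge>1. \<forall>j\<in>{1..<J}. F m j = F0 m j + dx_hat x (F1 m) j" "\<forall>m\<ge>1. F1 m J = 0"
      let ?P = "K_const \<sigma> / sqrt (c_const \<theta> * \<rho>\<^sub>l) * (\<Sum>m = 1..M. norm_\<omega> x J (F0 m) * mesh_step t m)"
      have "?P \<ge> 0"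
        using c_const_pos[OF \<theta>] rho_lower(1) sigma \<tau>_pos ip_\<omega>_nonneg
        by (intro mult_nonneg_nonneg divide_nonneg_nonneg sum_nonneg)
           (auto simp: K_const_def norm_\<omega>_def less_imp_le)
      then show "max (Max ((\<lambda>m. norm_C x J \<theta> \<rho>\<^sub>h (U m)) ` {0..M}))
          (sqrt 2 * energy_norm x J t \<sigma> \<theta> \<rho>\<^sub>h b\<^sub>h c\<^sub>h M U)
        \<le> norm_C x J \<theta> \<rho>\<^sub>h U\<^sub>0 + ?P
          + sqrt (2 / \<nu>) * (norm_space_time x J t M F1 + sqrt X * norm_time t M G)"
        by (rule bound[where f = F0, OF sol F]) (rule load_pairing_bound[OF \<theta>])
    next
      fix U M F1
      assume sol: "?sol U"
        and F: "\<forall>m\<ge>1. \<forall>j\<in>{1..<J}. F m j = dx_hat x (F1 m) j" "\<forall>m\<ge>1. F1 m J = 0"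
      show "max (Max ((\<lambda>m. norm_C x J \<theta> \<rho>\<^sub>h (U m)) ` {0..M}))
          (sqrt 2 * energy_norm x J t \<sigma> \<theta> \<rho>\<^sub>h b\<^sub>h c\<^sub>h M U)
        \<le> norm_C x J \<theta> \<rho>\<^sub>h U\<^sub>0
          + sqrt (2 / \<nu>) * (norm_space_time x J t M F1 + sqrt X * norm_time t M G)"
        using bound[where U = U and f = "\<lambda>_ _. 0" and g = F1 and P = 0 and M = M, OF sol _ F(2)] F(1)
        by (simp add: ip_\<omega>_def)
    next
      have "\<exists>U. ?sol U" unfolding sol_iff by (rule scheme_exists) (rule init(1))
      then obtain U where U: "?sol U" by (rule exE)
      have "V m j = U m j" if V: "?sol V" and j: "j \<le> J" for V m j
      proof (rule scheme_unique[where f = "\<lambda>m j. if j < J then F m j else G m"])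
        show "residual U m j = (if j < J then F m j else G m)" if "m \<ge> 1" "j \<in> {1..J}" for m j
          using U that unfolding sol_iff by blast
        show "residual V m j = (if j < J then F m j else G m)" if "m \<ge> 1" "j \<in> {1..J}" for m j
          using V that unfolding sol_iff by blast
        show "U m 0 = 0" "V m 0 = 0" if "m \<ge> 1" for m
          using U V that unfolding sol_iff by blast+
        show "V 0 j = U 0 j" if "j \<le> J" for j
          using U V that unfolding sol_iff by simp
      qed (fact j)
      then have "\<forall>V. ?sol V \<longrightarrow> (\<forall>m. \<forall>j\<le>J. V m j = U m j)" by blast
      with U show "\<exists>U. ?sol U \<and> (\<forall>V. ?sol V \<longrightarrow> (\<forall>m. \<forall>j\<le>J. V m j = U m j))"
        by (intro exI[of _ U] conjI)
    qed
  qed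
qed

end
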